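(* Let $s, t \geq 2$ be integers, let $G$ be a $K^{\ast}_{s,t}$-minor-free graph, and let $(T, \mathcal{W})$ be a tree-decomposition of $G$. Then $G$ has a partition $H$ of $\mathcal{W}$-width at most $t-1$ such that $H$ has simple treewidth at most $s$.
   Context: All graphs are finite, simple and undirected. $K^{\ast}_{s,t}$ is the graph whose vertex-set is partitioned into $A \cup B$ with $|A| = s$, $|B| = t$, $A$ a clique, $B$ an independent set, and every vertex of $A$ adjacent to every vertex of $B$. A tree-decomposition $(T,\mathcal{W})$, $\mathcal{W}=(W_x : x\in V(T))$, has bags $W_x\subseteq V(G)$ such that each vertex's bags induce a non-empty connected subtree of $T$ and each edge lies in some bag; its width is the maximum bag size minus one. A tree-decomposition is $k$-simple if it has width at most $k$ and every set $S$ of $k$ vertices is contained in at most two bags. The simple treewidth of a graph is the minimum $k \in \mathbb{N}$ such that it has a $k$-simple tree-decomposition. A partition of $G$ is a graph $H$ whose vertices (parts) are sets of vertices of $G$, each vertex of $G$ lying in exactly one part, such that for every edge $vw$ of $G$ with $v\in X$, $w\in Y$ ($X,Y\in V(H)$), either $X=Y$ or $XY\in E(H)$. The $\mathcal{W}$-width of a set $S\subseteq V(G)$ is the minimum number of bags of $\mathcal{W}$ whose union contains $S$; the $\mathcal{W}$-width of a partition is the maximum $\mathcal{W}$-width of its parts. *)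

theory Defs
  imports "Graph_Theory.Graph_Theory"
begin

text \<open>
  A finite simple undirected graph is a \<^const>\<open>pair_graph\<close>: each undirected edge is
  represented by both of its orientations. Note that \<^const>\<open>connected\<close> includes
  non-emptiness.
\<close>

text \<open>
  The library's \<^const>\<open>tree\<close> forbids directed cycles, hence also the closed walk
  \<open>u, v, u\<close> along a single undirected edge. In a symmetric loop-free graph without
  parallel arcs, the undirected cycles are the directed ones of length at least 3.
\<close>

definition undirected_tree :: "'x pair_pre_digraph \<Rightarrow> bool" where
  "undirected_tree T \<longleftrightarrow>
     pair_graph T \<and> connected T \<and> \<not> (\<exists>p. pre_digraph.cycle T p \<and> 3 \<le> length p)"

definition K_star :: "nat \<Rightarrow> nat \<Rightarrow> (nat + nat) pair_pre_digraph" where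
  "K_star s t =
     (let A = Inl ` {..<s}; B = Inr ` {..<t}
      in \<lparr>pverts = A \<union> B, parcs = (A \<times> A - Id) \<union> A \<times> B \<union> B \<times> A\<rparr>)"

lemma pair_graph_K_star: "pair_graph (K_star s t)"
proof
  show "finite (parcs (K_star s t))"
    by (rule finite_subset[of _ "(Inl ` {..<s} \<union> Inr ` {..<t}) \<times> (Inl ` {..<s} \<union> Inr ` {..<t})"])
       (auto simp: K_star_def Let_def)
qed (auto simp: K_star_def Let_def symmetric_def sym_def)

text \<open>\<open>M\<close> assigns to each vertex of \<open>K\<close> its branch set in \<open>G\<close>.\<close>

definition minor_model ::
  "'k pair_pre_digraph \<Rightarrow> 'a pair_pre_digraph \<Rightarrow> ('k \<Rightarrow> 'a set) \<Rightarrow> bool" where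
  "minor_model K G M \<longleftrightarrow>
     (\<forall>u\<in>pverts K. M u \<subseteq> pverts G \<and> connected (with_proj G \<restriction> M u)) \<and>
     (\<forall>u\<in>pverts K. \<forall>v\<in>pverts K. u \<noteq> v \<longrightarrow> M u \<inter> M v = {}) \<and>
     (\<forall>(u, v)\<in>parcs K. \<exists>x\<in>M u. \<exists>y\<in>M v. (x, y) \<in> parcs G)"

definition is_minor :: "'k pair_pre_digraph \<Rightarrow> 'a pair_pre_digraph \<Rightarrow> bool" where
  "is_minor K G \<longleftrightarrow> (\<exists>M. minor_model K G M)"

definition minor_free :: "'k pair_pre_digraph \<Rightarrow> 'a pair_pre_digraph \<Rightarrow> bool" where
  "minor_free K G \<longleftrightarrow> \<not> is_minor K G"

definition tree_decomposition ::
  "'a pair_pre_digraph \<Rightarrow> 'x pair_pre_digraph \<Rightarrow> ('x \<Rightarrow> 'a set) \<Rightarrow> bool" where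
  "tree_decomposition G T W \<longleftrightarrow>
     undirected_tree T \<and>
     (\<forall>x\<in>pverts T. W x \<subseteq> pverts G) \<and>
     (\<forall>v\<in>pverts G. connected (with_proj T \<restriction> {x \<in> pverts T. v \<in> W x})) \<and>
     (\<forall>(u, v)\<in>parcs G. \<exists>x\<in>pverts T. u \<in> W x \<and> v \<in> W x)"

text \<open>Integer-valued, since the graph without vertices has a decomposition of width \<open>-1\<close>.\<close>

definition td_width :: "'x pair_pre_digraph \<Rightarrow> ('x \<Rightarrow> 'a set) \<Rightarrow> int" where
  "td_width T W = int (Max ((\<lambda>x. card (W x)) ` pverts T)) - 1"

definition simple_tree_decomposition ::
  "nat \<Rightarrow> 'a pair_pre_digraph \<Rightarrow> 'x pair_pre_digraph \<Rightarrow> ('x \<Rightarrow> 'a set) \<Rightarrow> bool" where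
  "simple_tree_decomposition k G T W \<longleftrightarrow>
     tree_decomposition G T W \<and> td_width T W \<le> int k \<and>
     (\<forall>S. S \<subseteq> pverts G \<and> card S = k \<longrightarrow> card {x \<in> pverts T. S \<subseteq> W x} \<le> 2)"

text \<open>
  Trees on natural numbers suffice, because decomposition trees are finite. The minimum
  exists for every finite graph: the decomposition with a single bag is \<open>k\<close>-simple
  for large \<open>k\<close>.
\<close>

definition simple_treewidth :: "'a pair_pre_digraph \<Rightarrow> nat" where
  "simple_treewidth G =
     (LEAST k. \<exists>(T :: nat pair_pre_digraph) W. simple_tree_decomposition k G T W)"

lemma undirected_tree_single: "undirected_tree \<lparr>pverts = {x}, parcs = {}\<rparr>"
proof -
  have "pair_graph \<lparr>pverts = {x}, parcs = {}\<rparr>"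
    by unfold_locales (auto simp: symmetric_def sym_def)
  moreover have "connected (with_proj \<lparr>pverts = {x}, parcs = {}\<rparr>)"
    by (auto simp: connected_def strongly_connected_def mk_symmetric_def reachable_def)
  ultimately show ?thesis
    by (auto simp: undirected_tree_def pre_digraph.cycle_def pre_digraph.awalk_def)
qed

lemma simple_tree_decomposition_exists:
  assumes "pair_graph G"
  shows "\<exists>k (T :: nat pair_pre_digraph) W. simple_tree_decomposition k G T W"
proof -
  interpret pair_graph G by fact
  let ?T = "\<lparr>pverts = {0}, parcs = {}\<rparr> :: nat pair_pre_digraph"
  have c: "connected (with_proj ?T \<restriction> {0})"
    by (auto simp: connected_def strongly_connected_def mk_symmetric_def reachable_def)
  have "tree_decomposition G ?T (\<lambda>_. pverts G)"
    using c by (auto simp: tree_decomposition_def undirected_tree_single wellformed' cong: conj_cong)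
  moreover have "card {x \<in> pverts ?T. S \<subseteq> pverts G} \<le> 2" for S
    by (rule order_trans[OF card_mono[of "{0}"]]) auto
  ultimately have "simple_tree_decomposition (card (pverts G)) G ?T (\<lambda>_. pverts G)"
    by (auto simp: simple_tree_decomposition_def td_width_def)
  then show ?thesis by blast
qed

definition graph_partition :: "'a pair_pre_digraph \<Rightarrow> 'a set pair_pre_digraph \<Rightarrow> bool" where
  "graph_partition G H \<longleftrightarrow>
     pair_graph H \<and>
     (\<forall>X\<in>pverts H. X \<subseteq> pverts G) \<and>
     (\<forall>v\<in>pverts G. \<exists>!X. X \<in> pverts H \<and> v \<in> X) \<and>
     (\<forall>(v, w)\<in>parcs G. \<forall>X\<in>pverts H. \<forall>Y\<in>pverts H.
        v \<in> X \<and> w \<in> Y \<longrightarrow> X = Y \<or> (X, Y) \<in> parcs H)"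

definition set_bag_width :: "'x pair_pre_digraph \<Rightarrow> ('x \<Rightarrow> 'a set) \<Rightarrow> 'a set \<Rightarrow> nat" where
  "set_bag_width T W S = (LEAST n. \<exists>X\<subseteq>pverts T. card X = n \<and> S \<subseteq> (\<Union>x\<in>X. W x))"

text \<open>
  The supremum over the finite set of parts is their maximum, and 0 if there are no parts.
\<close>

definition partition_bag_width ::
  "'x pair_pre_digraph \<Rightarrow> ('x \<Rightarrow> 'a set) \<Rightarrow> 'a set pair_pre_digraph \<Rightarrow> nat" where
  "partition_bag_width T W H = (SUP S\<in>pverts H. set_bag_width T W S)"

end

theory Submission
  imports Defs
begin

text \<open>
  The partition is grown together with a tree decomposition of the quotient. At each stage there
  are a set \<open>Y\<close> of vertices still to be partitioned and a set \<open>\<X>\<close> of at most \<open>s\<close> parts that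
  contains all neighbours of \<open>Y\<close> outside \<open>Y\<close>; the members of \<open>\<X>\<close> lie in the branch sets of a
  complete minor avoiding \<open>Y\<close>. Call a connected subset of \<open>Y\<close> full if it has a neighbour in every
  member of \<open>\<X>\<close>.

  If \<open>\<X>\<close> has \<open>s\<close> members, there are no \<open>t\<close> disjoint full sets, as these would yield a
  \<open>K\<^sup>*\<^sub>s\<^sub>,\<^sub>t\<close> minor, so by the Erdos-Posa property of subtrees \<open>t - 1\<close> bags meet all full sets.
  A minimal set \<open>S\<close> of vertices from these bags meeting all full sets is the next part. Each
  component of \<open>Y - S\<close> misses some \<open>X \<in> \<X>\<close>, and the components missing \<open>X\<close> are treated
  together, with \<open>S\<close> in place of \<open>X\<close>. By minimality, every vertex of \<open>S\<close> is linked to \<open>X\<close>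
  outside these components, so \<open>S\<close> inherits (an enlargement of) the branch set of \<open>X\<close>. This
  replacement is also what makes the decomposition \<open>s\<close>-simple.

  If \<open>\<X>\<close> has fewer than \<open>s\<close> members, a full set \<open>Q\<close> as deep as possible in \<open>T\<close> provides a part \<open>S\<close>
  inside a single bag, and \<open>Q\<close> serves as the branch set of \<open>S\<close> towards the full components
  of \<open>Y - Q\<close>.
\<close>

section \<open>Connected sets\<close>

text \<open>Stated for a bare arc relation, with walks confined to \<open>Z\<close>, so that no
  induced subgraph has to be formed.\<close>

definition conn :: "'a rel \<Rightarrow> 'a set \<Rightarrow> bool" where
  "conn E Z \<longleftrightarrow> Z \<noteq> {} \<and> (\<forall>u\<in>Z. \<forall>v\<in>Z. (u, v) \<in> rtrancl_on Z E)"

text \<open>For symmetric \<open>E\<close>, the component of \<open>v\<close> in the subgraph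
  induced by \<open>R\<close>; empty if \<open>v \<notin> R\<close>.\<close>

definition comp_of :: "'a rel \<Rightarrow> 'a set \<Rightarrow> 'a \<Rightarrow> 'a set" where
  "comp_of E R v = {w. (v, w) \<in> rtrancl_on R E}"

lemma rtrancl_on_mono_dom:
  assumes "(u, v) \<in> rtrancl_on A E" "A \<subseteq> B" shows "(u, v) \<in> rtrancl_on B E"
  using assms by (induction rule: rtrancl_on_induct) (auto intro: rtrancl_on_into_rtrancl_on)

lemma rtrancl_on_symD:
  assumes "(u, v) \<in> rtrancl_on A E" "sym E" shows "(v, u) \<in> rtrancl_on A E"
  using rtrancl_on_sym[OF assms(2)] assms(1) by (rule symD)

lemma connected_induce_iff_conn:
  assumes "sym (parcs G)"
  shows "connected (with_proj G \<restriction> Z) \<longleftrightarrow> conn (parcs G) Z"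
proof -
  let ?E = "parcs G"
  have ar: "parcs (mk_symmetric (with_proj G \<restriction> Z)) = ?E \<inter> Z \<times> Z"
    using assms by (auto simp: mk_symmetric_def induce_subgraph_def dest: symD)
  have eq: "rtrancl_on Z (?E \<inter> Z \<times> Z) = rtrancl_on Z ?E"
  proof (intro equalityI subrelI)
    fix u v assume "(u, v) \<in> rtrancl_on Z (?E \<inter> Z \<times> Z)"
    then show "(u, v) \<in> rtrancl_on Z ?E"
      by (induction rule: rtrancl_on_induct) (auto intro: rtrancl_on_into_rtrancl_on)
  next
    fix u v assume "(u, v) \<in> rtrancl_on Z ?E"
    then show "(u, v) \<in> rtrancl_on Z (?E \<inter> Z \<times> Z)"
      by (induction rule: rtrancl_on_induct) (auto intro: rtrancl_on_into_rtrancl_on)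
  qed
  have "pverts (mk_symmetric (with_proj G \<restriction> Z)) = Z"
    by (simp add: mk_symmetric_def)
  then show ?thesis
    by (simp add: connected_def strongly_connected_def conn_def reachable_def ar eq)
qed

lemma conn_nonempty: "conn E Z \<Longrightarrow> Z \<noteq> {}"
  by (simp add: conn_def)

text \<open>A walk inside \<open>Z\<close> starts in \<open>A\<close> and finds no arc on which to
  leave it. This traps connected sets on one side of a separation.\<close>

lemma conn_subset_closed:
  assumes "conn E Z" "z \<in> Z" "z \<in> A"
    and "\<And>u v. u \<in> A \<Longrightarrow> u \<in> Z \<Longrightarrow> v \<in> Z \<Longrightarrow> (u, v) \<in> E \<Longrightarrow> v \<in> A"
  shows "Z \<subseteq> A"
proof
  fix v assume "v \<in> Z"
  then have "(z, v) \<in> rtrancl_on Z E" using assms(1,2) by (auto simp: conn_def)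
  then show "v \<in> A" by (induction rule: rtrancl_on_induct) (use assms in auto)
qed

lemma conn_from_root:
  assumes "sym E" "a \<in> Z" "\<And>v. v \<in> Z \<Longrightarrow> (a, v) \<in> rtrancl_on Z E"
  shows "conn E Z"
  unfolding conn_def
proof (intro conjI ballI)
  fix u v assume "u \<in> Z" "v \<in> Z"
  then show "(u, v) \<in> rtrancl_on Z E"
    using assms by (meson rtrancl_on_symD rtrancl_on_trans)
qed (use assms in auto)

lemma comp_of_self: "v \<in> R \<Longrightarrow> v \<in> comp_of E R v"
  by (simp add: comp_of_def)

lemma comp_of_subset: "comp_of E R v \<subseteq> R"
  by (auto simp: comp_of_def dest: in_rtrancl_on_in_F)

lemma comp_of_closed:
  "u \<in> comp_of E R v \<Longrightarrow> (u, w) \<in> E \<Longrightarrow> w \<in> R \<Longrightarrow> w \<in> comp_of E R v"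
  by (auto simp: comp_of_def intro: rtrancl_on_into_rtrancl_on)

lemma conn_comp_of:
  assumes "sym E" "v \<in> R"
  shows "conn E (comp_of E R v)"
proof (rule conn_from_root[OF assms(1) comp_of_self[OF assms(2)]])
  fix w assume "w \<in> comp_of E R v"
  then have "(v, w) \<in> rtrancl_on R E" by (simp add: comp_of_def)
  then show "(v, w) \<in> rtrancl_on (comp_of E R v) E"
  proof (induction rule: rtrancl_on_induct)
    case (step y z)
    then have "z \<in> comp_of E R v"
      by (auto simp: comp_of_def intro: rtrancl_on_into_rtrancl_on)
    then show ?case using step by (meson rtrancl_on_into_rtrancl_on)
  qed (use assms comp_of_self in auto)
qed

lemma conn_subset_comp_of:
  assumes "conn E Z" "Z \<subseteq> R" "z \<in> Z" "z \<in> comp_of E R v"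
  shows "Z \<subseteq> comp_of E R v"
  by (rule conn_subset_closed[OF assms(1,3,4)]) (use assms(2) in \<open>auto intro: comp_of_closed\<close>)

lemma comp_of_eq:
  assumes "sym E" "w \<in> comp_of E R v"
  shows "comp_of E R w = comp_of E R v"
proof -
  have vw: "(v, w) \<in> rtrancl_on R E" using assms(2) by (simp add: comp_of_def)
  then have "(w, v) \<in> rtrancl_on R E" using assms(1) by (rule rtrancl_on_symD)
  with vw show ?thesis unfolding comp_of_def by (blast intro: rtrancl_on_trans)
qed

definition adj :: "'a rel \<Rightarrow> 'a set \<Rightarrow> 'a set \<Rightarrow> bool" where
  "adj E A B \<longleftrightarrow> (\<exists>u\<in>A. \<exists>v\<in>B. (u, v) \<in> E)"

lemma adj_mono: "adj E A B \<Longrightarrow> A \<subseteq> A' \<Longrightarrow> B \<subseteq> B' \<Longrightarrow> adj E A' B'"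
  unfolding adj_def by blast

lemma adj_sym: "sym E \<Longrightarrow> adj E A B \<Longrightarrow> adj E B A"
  unfolding adj_def by (auto dest: symD)

lemma conn_UN_adj:
  assumes "sym E" "conn E A"
    and "\<And>i. i \<in> I \<Longrightarrow> conn E (C i)" "\<And>i. i \<in> I \<Longrightarrow> A \<inter> C i \<noteq> {} \<or> adj E (C i) A"
  shows "conn E (A \<union> (\<Union>i\<in>I. C i))"
proof -
  let ?Z = "A \<union> (\<Union>i\<in>I. C i)"
  obtain a where a: "a \<in> A" using assms(2) by (auto simp: conn_def)
  have A: "(a, v) \<in> rtrancl_on ?Z E" if "v \<in> A" for v
    using assms(2) a that by (auto simp: conn_def intro: rtrancl_on_mono_dom)
  show ?thesis
  proof (rule conn_from_root[OF assms(1), of a])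
    fix v assume "v \<in> ?Z"
    show "(a, v) \<in> rtrancl_on ?Z E"
    proof (cases "v \<in> A")
      case False
      then obtain i where i: "i \<in> I" "v \<in> C i" using \<open>v \<in> ?Z\<close> by auto
      have sub: "C i \<subseteq> ?Z" using i by auto
      have C: "(c, v) \<in> rtrancl_on ?Z E" if "c \<in> C i" for c
        using assms(3)[OF i(1)] that i(2) rtrancl_on_mono_dom[OF _ sub] by (auto simp: conn_def)
      show ?thesis using assms(4)[OF i(1)]
      proof
        assume "A \<inter> C i \<noteq> {}"
        then show ?thesis using A C by (meson disjoint_iff rtrancl_on_trans)
      next
        assume "adj E (C i) A"
        then obtain c b where cb: "c \<in> C i" "b \<in> A" "(c, b) \<in> E" by (auto simp: adj_def)
        have "(a, c) \<in> rtrancl_on ?Z E"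
          using A[OF cb(2)] cb sub assms(1) by (meson rtrancl_on_into_rtrancl_on subsetD symD)
        then show ?thesis using C[OF cb(1)] by (rule rtrancl_on_trans)
      qed
    qed (rule A)
  qed (use a in auto)
qed

section \<open>Separations in tree decompositions\<close>

text \<open>\<open>undirected_tree\<close> forbids cycles, which are arc lists; reachability is
  turned into a path so that such a list can be assembled.\<close>

lemma rtrancl_on_imp_apath:
  assumes "pair_wf_digraph T" "R \<subseteq> pverts T" "(u, v) \<in> rtrancl_on R (parcs T)"
  shows "\<exists>p. pre_digraph.apath (with_proj T) u p v \<and> set (pawalk_verts u p) \<subseteq> R"
proof -
  interpret pair_wf_digraph T by fact
  have "\<exists>p. awalk u p v \<and> set (pawalk_verts u p) \<subseteq> R"
    using assms(3)
  proof (induction rule: rtrancl_on_induct)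
    case base
    then show ?case using assms(2) by (intro exI[of _ "[]"]) (auto simp: awalk_def)
  next
    case (step y z)
    then obtain p where p: "awalk u p y" "set (pawalk_verts u p) \<subseteq> R" by auto
    have a: "awalk y [(y, z)] z" using step assms(2) by (auto simp: awalk_def)
    have "awalk u (p @ [(y, z)]) z" using p(1) a by auto
    moreover have "set (pawalk_verts u (p @ [(y, z)])) \<subseteq> R"
      using set_awalk_verts_append[OF p(1) a] p(2) step by auto
    ultimately show ?case by blast
  qed
  then obtain p where p: "awalk u p v" "set (pawalk_verts u p) \<subseteq> R" by auto
  have q: "apath u (awalk_to_apath p) v" using p(1) by (rule apath_awalk_to_apath)
  have "set (pawalk_verts u (awalk_to_apath p)) \<subseteq> R"
    using set_awalk_verts[OF awalkI_apath[OF q]] set_awalk_verts[OF p(1)]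
      awalk_to_apath_subset[OF p(1)] p(2) by (simp add: image_subset_iff) blast
  with q show ?thesis by blast
qed

text \<open>A path in \<open>R\<close> between two such neighbours would close up through
  \<open>x\<close> to a cycle.\<close>

lemma tree_unique_neighbour:
  assumes "undirected_tree T" "conn (parcs T) R" "R \<subseteq> pverts T" "x \<notin> R"
    and "y \<in> R" "(x, y) \<in> parcs T" "y' \<in> R" "(x, y') \<in> parcs T"
  shows "y = y'"
proof (rule ccontr)
  assume "y \<noteq> y'"
  interpret pair_graph T using assms(1) by (simp add: undirected_tree_def)
  have "(y, y') \<in> rtrancl_on R (parcs T)" using assms by (auto simp: conn_def)
  then obtain p where p: "apath y p y'" "set (pawalk_verts y p) \<subseteq> R"
    using rtrancl_on_imp_apath[OF _ assms(3)] pair_wf_digraph_axioms by blast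
  have sy: "(y', x) \<in> parcs T" using assms(8) pair_sym_arcs by (auto simp: symmetric_def dest: symD)
  have pw: "awalk y p y'" and pd: "distinct (pawalk_verts y p)" using p(1) by (auto simp: apath_def)
  have pne: "p \<noteq> []" using pw \<open>y \<noteq> y'\<close> by auto
  \<comment> \<open>\<open>p\<close> is non-empty because \<open>y \<noteq> y'\<close>, so this
    closed walk has length at least 3. Distinctness is asked of its vertices without the first,
    where \<open>x\<close> occurs only at the end.\<close>
  let ?q = "(x, y) # p @ [(y', x)]"
  have a: "awalk y' [(y', x)] x" using sy by (auto simp: awalk_def in_arcsD1)
  have "awalk y (p @ [(y', x)]) x" using pw a by auto
  then have q: "awalk x ?q x" using assms(6) by (auto simp: awalk_Cons_iff)
  have "pawalk_verts y (p @ [(y', x)]) = pawalk_verts y p @ tl (pawalk_verts (last (pawalk_verts y p)) [(y', x)])"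
    using awalk_verts_append[of y p "[(y', x)]" x] pw a by auto
  then have "tl (pawalk_verts x ?q) = pawalk_verts y p @ [x]" by simp
  then have "distinct (tl (pawalk_verts x ?q))" using pd p(2) assms(4) by auto
  then have "cycle ?q" using q unfolding cycle_def by blast
  moreover have "3 \<le> length ?q" using pne by (cases p) auto
  ultimately show False using assms(1) by (auto simp: undirected_tree_def)
qed

text \<open>Consecutive vertices of a walk in \<open>Z\<close> share a bag, so their subtrees
  overlap.\<close>

lemma tree_decomposition_nodes_conn:
  assumes "tree_decomposition G T W" "sym (parcs T)" "sym (parcs G)" "conn (parcs G) Z" "Z \<subseteq> pverts G"
  shows "conn (parcs T) {x \<in> pverts T. W x \<inter> Z \<noteq> {}}"
proof -
  let ?N = "\<lambda>v. {x \<in> pverts T. v \<in> W x}"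
  let ?M = "{x \<in> pverts T. W x \<inter> Z \<noteq> {}}"
  have N: "conn (parcs T) (?N v)" if "v \<in> pverts G" for v
    using assms(1,2) that by (auto simp: tree_decomposition_def connected_induce_iff_conn)
  obtain z where z: "z \<in> Z" using assms(4) by (auto simp: conn_def)
  obtain a where a: "a \<in> ?N z" using N[of z] z assms(5) by (auto simp: conn_def)
  have R: "\<forall>x\<in>?N v. (a, x) \<in> rtrancl_on ?M (parcs T)" if "v \<in> Z" for v
  proof -
    have "(z, v) \<in> rtrancl_on Z (parcs G)" using assms(4) z that by (auto simp: conn_def)
    then show ?thesis
    proof (induction rule: rtrancl_on_induct)
      case base
      have "?N z \<subseteq> ?M" using z by auto
      then show ?case using N[of z] a z assms(5) by (auto simp: conn_def intro: rtrancl_on_mono_dom)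
    next
      case (step u v)
      obtain b where b: "b \<in> ?N u" "b \<in> ?N v"
        using step(2) assms(1) by (auto simp: tree_decomposition_def)
      have "?N v \<subseteq> ?M" using step by auto
      then have "\<forall>x\<in>?N v. (b, x) \<in> rtrancl_on ?M (parcs T)"
        using N[of v] b step assms(5) by (auto simp: conn_def intro: rtrancl_on_mono_dom)
      then show ?case using step b by (meson rtrancl_on_trans)
    qed
  qed
  show ?thesis
  proof (rule conn_from_root[OF assms(2), of a])
    show "a \<in> ?M" using a z by auto
    show "(a, v) \<in> rtrancl_on ?M (parcs T)" if "v \<in> ?M" for v using that R by auto
  qed
qed

section \<open>Packing and covering connected sets by bags\<close>

text \<open>
  Think of \<open>T\<close> as rooted. Among all subtrees \<open>R\<close>, attached to the rest of \<open>T\<close> only at their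
  top node \<open>x\<close>, whose bags cover a member of the family, take a smallest one.
\<close>

lemma deepest_bag:
  assumes G: "pair_graph G" and td: "tree_decomposition G T W" and "Y \<subseteq> pverts G"
    and F: "\<And>Z. F Z \<Longrightarrow> conn (parcs G) Z" and "Z0 \<subseteq> Y" "F Z0"
  obtains x U where "x \<in> pverts T"
    "\<And>u v. u \<in> U \<Longrightarrow> u \<notin> W x \<Longrightarrow> (u, v) \<in> parcs G \<Longrightarrow> v \<in> U"
    "\<exists>Z\<subseteq>Y \<inter> U. F Z" "\<not> (\<exists>Z\<subseteq>Y \<inter> U - W x. F Z)"
proof -
  interpret G: pair_graph G by fact
  have tree: "undirected_tree T" using td by (simp add: tree_decomposition_def)
  interpret T: pair_graph T using tree by (simp add: undirected_tree_def)
  have symG: "sym (parcs G)" using G.pair_sym_arcs by (simp add: symmetric_def)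
  have symT: "sym (parcs T)" using T.pair_sym_arcs by (simp add: symmetric_def)
  \<comment> \<open>\<open>x\<close> is the top node of \<open>R\<close>: arcs may leave
    \<open>R\<close> only from \<open>x\<close>.\<close>
  define att where "att = (\<lambda>(x, R). x \<in> R \<and> R \<subseteq> pverts T \<and>
      (\<forall>a\<in>R - {x}. \<forall>b. (a, b) \<in> parcs T \<longrightarrow> b \<in> R) \<and>
      (\<exists>Z\<subseteq>Y \<inter> (\<Union>a\<in>R. W a). F Z))"
  have nodes: "conn (parcs T) {a \<in> pverts T. W a \<inter> Z \<noteq> {}}" if "conn (parcs G) Z" "Z \<subseteq> pverts G" for Z
    using tree_decomposition_nodes_conn[OF td symT symG that] .
  have cover: "\<exists>a\<in>pverts T. v \<in> W a" if "v \<in> pverts G" for v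
  proof -
    have "conn (parcs G) {v}" by (simp add: conn_def)
    then show ?thesis using nodes[of "{v}"] that by (auto simp: conn_def)
  qed
  have ex: "\<exists>q. att q"
  proof -
    obtain z where "z \<in> Z0" using F[OF assms(6)] by (auto simp: conn_def)
    then obtain a where "a \<in> pverts T" using cover assms(3,5) by blast
    \<comment> \<open>The whole tree, topped by any of its nodes, is a candidate.\<close>
    then have "att (a, pverts T)"
      unfolding att_def case_prod_conv
      by (intro conjI exI[of _ Z0]) (use assms(3,5,6) cover in \<open>auto dest: T.in_arcsD2\<close>)
    then show ?thesis by blast
  qed
  obtain q where q: "att q" "\<And>q'. att q' \<Longrightarrow> card (snd q) \<le> card (snd q')"
    using ex_has_least_nat[of att _ "\<lambda>q. card (snd q)"] ex by blast
  obtain x R where [simp]: "q = (x, R)" by (cases q)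
  have x: "x \<in> R" "R \<subseteq> pverts T" and cl: "\<And>a b. a \<in> R \<Longrightarrow> a \<noteq> x \<Longrightarrow> (a, b) \<in> parcs T \<Longrightarrow> b \<in> R"
    using q(1) by (auto simp: att_def)
  have finR: "finite R" using x(2) T.pair_finite_verts by (rule finite_subset)
  \<comment> \<open>The nodes whose bags meet \<open>Z\<close> form a subtree missing
    \<open>x\<close>, so it cannot get out of \<open>R\<close> through the top.\<close>
  have stay: "{a \<in> pverts T. W a \<inter> Z \<noteq> {}} \<subseteq> R - {x}"
    if "conn (parcs G) Z" "Z \<subseteq> pverts G" "Z \<inter> W x = {}" "z \<in> Z" "z \<in> W a" "a \<in> R" for Z z a
  proof (rule conn_subset_closed[OF nodes[OF that(1,2)], of a])
    show "a \<in> {a \<in> pverts T. W a \<inter> Z \<noteq> {}}" using that x(2) by auto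
    show "a \<in> R - {x}" using that by auto
  qed (use cl that(3) in auto)
  show thesis
  proof (rule that[of x "\<Union>a\<in>R. W a"])
    show "x \<in> pverts T" using x by auto
    show "\<exists>Z\<subseteq>Y \<inter> \<Union> (W ` R). F Z" using q(1) by (simp add: att_def)
    fix u v assume u: "u \<in> \<Union> (W ` R)" "u \<notin> W x" "(u, v) \<in> parcs G"
    then obtain a where a: "a \<in> R" "u \<in> W a" by auto
    have "conn (parcs G) {u}" by (simp add: conn_def)
    then have "{a \<in> pverts T. W a \<inter> {u} \<noteq> {}} \<subseteq> R - {x}"
      using stay[of "{u}" u a] u a G.in_arcsD1 by auto
    moreover obtain b where "b \<in> pverts T" "u \<in> W b" "v \<in> W b"
      using u(3) td by (auto simp: tree_decomposition_def)
    ultimately show "v \<in> \<Union> (W ` R)" by auto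
  next
    show "\<not> (\<exists>Z\<subseteq>Y \<inter> \<Union> (W ` R) - W x. F Z)"
    proof
      assume "\<exists>Z\<subseteq>Y \<inter> \<Union> (W ` R) - W x. F Z"
      then obtain Z where Z: "Z \<subseteq> Y \<inter> \<Union> (W ` R) - W x" "F Z" by auto
      have cZ: "conn (parcs G) Z" "Z \<subseteq> pverts G" using F Z assms(3) by auto
      obtain z a where z: "z \<in> Z" "z \<in> W a" "a \<in> R" using Z conn_nonempty[OF cZ(1)] by blast
      let ?M = "{a \<in> pverts T. W a \<inter> Z \<noteq> {}}"
      have M: "?M \<subseteq> R - {x}" using stay[OF cZ _ z] Z by auto
      \<comment> \<open>A member avoiding \<open>W x\<close> lives in a single component
        \<open>C\<close> of \<open>R - {x}\<close>, and \<open>C\<close> would be a smaller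
        candidate.\<close>
      define C where "C = comp_of (parcs T) (R - {x}) a"
      have aM: "a \<in> ?M" using z x(2) by auto
      have aR: "a \<in> R - {x}" using aM M by blast
      have C: "conn (parcs T) C" "C \<subseteq> R - {x}" "a \<in> C"
        unfolding C_def
        by (rule conn_comp_of[OF symT aR], rule comp_of_subset, rule comp_of_self[OF aR])
      have MC: "?M \<subseteq> C" unfolding C_def
        by (rule conn_subset_comp_of[OF nodes[OF cZ] M aM]) (use C(3) in \<open>simp add: C_def\<close>)
      have "Z \<subseteq> Y \<inter> (\<Union>a\<in>C. W a)"
      proof
        fix w assume w: "w \<in> Z"
        then obtain b where b: "b \<in> R" "w \<in> W b" using Z(1) by auto
        then have "b \<in> ?M" using w x(2) by auto
        then show "w \<in> Y \<inter> (\<Union>a\<in>C. W a)" using MC Z(1) w b by auto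
      qed
      then have full: "\<exists>Z\<subseteq>Y \<inter> (\<Union>a\<in>C. W a). F Z" using Z(2) by blast
      have out: "b = x" if "c \<in> C" "(c, b) \<in> parcs T" "b \<notin> C" for b c
        using that C(2) cl comp_of_closed[of c "parcs T" "R - {x}" a b] unfolding C_def by blast
      \<comment> \<open>As \<open>x\<close> has at most one neighbour in \<open>C\<close>, that
        neighbour is the only exit and becomes the top of \<open>C\<close>. If there is none, no arc
        leaves \<open>C\<close> and the default \<open>a\<close> will do.\<close>
      define y where "y = (if \<exists>c\<in>C. (x, c) \<in> parcs T then SOME c. c \<in> C \<and> (x, c) \<in> parcs T else a)"
      have y: "y \<in> C" "c \<in> C \<Longrightarrow> (x, c) \<in> parcs T \<Longrightarrow> c = y" for c
      proof -
        have *: "y \<in> C \<and> (x, y) \<in> parcs T" if "\<exists>c\<in>C. (x, c) \<in> parcs T"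
          using someI_ex[of "\<lambda>c. c \<in> C \<and> (x, c) \<in> parcs T"] that by (auto simp: y_def)
        show "y \<in> C" using * C(3) by (cases "\<exists>c\<in>C. (x, c) \<in> parcs T") (auto simp: y_def)
        show "c = y" if "c \<in> C" "(x, c) \<in> parcs T"
          using tree_unique_neighbour[OF tree C(1) _ _ that(1,2)] * that C(2) x(2) by blast
      qed
      have "b \<in> C" if "c \<in> C - {y}" "(c, b) \<in> parcs T" for b c
        using out[of c b] y(2)[of c] that symD[OF symT that(2)] by blast
      then have "att (y, C)"
        unfolding att_def case_prod_conv using y(1) full C(2) x(2) by (intro conjI) (blast | assumption)+
      then have "card R \<le> card C" using q(2) by fastforce
      moreover have "card C < card R" using C(2) x(1) finR by (intro psubset_card_mono) auto
      ultimately show False by simp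
    qed
  qed
qed

text \<open>Erdos-Posa by induction on \<open>Y\<close>: a member inside \<open>U\<close> enters the
  packing, the node \<open>x\<close> enters the cover, and the argument goes on in
  \<open>Y - U\<close>.\<close>

lemma disjoint_or_hitting:
  assumes G: "pair_graph G" and td: "tree_decomposition G T W" and "Y \<subseteq> pverts G"
    and F: "\<And>Z. F Z \<Longrightarrow> conn (parcs G) Z"
  shows "\<exists>\<Z> X. finite \<Z> \<and> disjoint \<Z> \<and> (\<forall>Z\<in>\<Z>. Z \<subseteq> Y \<and> F Z) \<and>
    X \<subseteq> pverts T \<and> card X \<le> card \<Z> \<and> (\<forall>Z\<subseteq>Y. F Z \<longrightarrow> Z \<inter> (\<Union>x\<in>X. W x) \<noteq> {})"
  using assms(3)
proof (induction "card Y" arbitrary: Y rule: less_induct)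
  case less
  show ?case
  proof (cases "\<exists>Z\<subseteq>Y. F Z")
    case False
    then show ?thesis by (intro exI[of _ "{}"]) auto
  next
    case True
    then obtain Z1 where "Z1 \<subseteq> Y" "F Z1" by auto
    then obtain x U where x: "x \<in> pverts T"
      "\<And>u v. u \<in> U \<Longrightarrow> u \<notin> W x \<Longrightarrow> (u, v) \<in> parcs G \<Longrightarrow> v \<in> U"
      "\<exists>Z\<subseteq>Y \<inter> U. F Z" "\<not> (\<exists>Z\<subseteq>Y \<inter> U - W x. F Z)"
      using deepest_bag[where F = F, OF G td less.prems F] by metis
    obtain Z0 where Z0: "Z0 \<subseteq> Y \<inter> U" "F Z0" using x(3) by auto
    have Z0ne: "Z0 \<noteq> {}" using F[OF Z0(2)] by (simp add: conn_def)
    have fin: "finite Y" using less.prems G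
      by (meson finite_subset pair_fin_digraph.pair_finite_verts pair_graph.axioms(1) pair_digraph.axioms(1))
    have "card (Y - U) < card Y" using Z0 Z0ne fin by (intro psubset_card_mono) auto
    moreover have "Y - U \<subseteq> pverts G" using less.prems by auto
    ultimately have "\<exists>\<Z> X. finite \<Z> \<and> disjoint \<Z> \<and> (\<forall>Z\<in>\<Z>. Z \<subseteq> Y - U \<and> F Z) \<and>
      X \<subseteq> pverts T \<and> card X \<le> card \<Z> \<and> (\<forall>Z\<subseteq>Y - U. F Z \<longrightarrow> Z \<inter> (\<Union>x\<in>X. W x) \<noteq> {})"
      by (rule less.hyps)
    then obtain \<Z> X where IH: "finite \<Z>" "disjoint \<Z>" "\<forall>Z\<in>\<Z>. Z \<subseteq> Y - U \<and> F Z"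
      "X \<subseteq> pverts T" "card X \<le> card \<Z>" "\<forall>Z\<subseteq>Y - U. F Z \<longrightarrow> Z \<inter> (\<Union>x\<in>X. W x) \<noteq> {}"
      by (elim exE conjE) (rule that; assumption)
    \<comment> \<open>\<open>Z0\<close> is non-empty and lies in \<open>U\<close>, which the packing
      of \<open>Y - U\<close> avoids; so the packing really grows when the cover does.\<close>
    have nin: "Z0 \<notin> \<Z>" using IH(3) Z0 Z0ne by blast
    have hit: "Z \<inter> (\<Union>x\<in>insert x X. W x) \<noteq> {}" if Z: "Z \<subseteq> Y" "F Z" for Z
    proof
      assume e: "Z \<inter> (\<Union>x\<in>insert x X. W x) = {}"
      \<comment> \<open>A member missed by the older bags must enter \<open>U\<close>; avoiding
        \<open>W x\<close>, it is then confined to \<open>U\<close>, contrary to the choice of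
        \<open>x\<close>.\<close>
      then have "\<not> Z \<subseteq> Y - U" using IH(6)[rule_format, of Z, OF _ Z(2)] by blast
      then obtain z where z: "z \<in> Z" "z \<in> U - W x" using Z(1) e by auto
      have "Z \<subseteq> U - W x"
        by (rule conn_subset_closed[OF F[OF Z(2)] z]) (use x(2) e in auto)
      then have "Z \<subseteq> Y \<inter> U - W x" using Z(1) by blast
      then show False using x(4) Z(2) by auto
    qed
    have "card (insert x X) \<le> card (insert Z0 \<Z>)"
      using IH(1,5) nin card_insert_le_m1[of "Suc (card \<Z>)" X x] by simp
    moreover have "disjoint (insert Z0 \<Z>)"
      using IH(2,3) Z0 unfolding pairwise_insert disjnt_def by blast
    moreover have "\<forall>Z\<in>insert Z0 \<Z>. Z \<subseteq> Y \<and> F Z" using IH(3) Z0 by auto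
    moreover have "\<forall>Z\<subseteq>Y. F Z \<longrightarrow> Z \<inter> (\<Union>x\<in>insert x X. W x) \<noteq> {}"
      by (intro allI impI hit)
    moreover have "finite (insert Z0 \<Z>)" "insert x X \<subseteq> pverts T" using IH(1,4) x(1) by auto
    ultimately show ?thesis
      by (intro exI[of _ "insert Z0 \<Z>"] exI[of _ "insert x X"] conjI)
  qed
qed

section \<open>Rooted models\<close>

definition full :: "'a rel \<Rightarrow> 'a set set \<Rightarrow> 'a set \<Rightarrow> bool" where
  "full E \<X> Z \<longleftrightarrow> conn E Z \<and> (\<forall>X\<in>\<X>. adj E Z X)"

text \<open>\<open>D\<close> is the region that will keep all of \<open>\<X>\<close> as roots, cut
  off within \<open>Y\<close> by \<open>S\<close>; in the rest of \<open>Y\<close>, \<open>S\<close>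
  has to meet every full set.\<close>

definition separates :: "'a rel \<Rightarrow> 'a set set \<Rightarrow> 'a set \<Rightarrow> 'a set \<Rightarrow> 'a set \<Rightarrow> bool" where
  "separates E \<X> Y D S \<longleftrightarrow> S \<subseteq> Y \<and> D \<inter> S = {} \<and>
     (\<forall>u\<in>D. \<forall>v\<in>Y. (u, v) \<in> E \<longrightarrow> v \<in> D \<union> S) \<and>
     (\<forall>Z. Z \<subseteq> Y - S - D \<longrightarrow> \<not> full E \<X> Z)"

text \<open>Each component of \<open>R\<close> misses some member of \<open>\<X>\<close>, which
  becomes its label. The vertices with a common label form a piece that can do without that
  root.\<close>

lemma exists_labelling:
  assumes "sym E" "\<forall>Z. Z \<subseteq> R \<longrightarrow> \<not> full E \<X> Z"
  obtains lab where "\<And>v. v \<in> R \<Longrightarrow> lab v \<in> \<X>"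
    "\<And>u v. u \<in> R \<Longrightarrow> v \<in> R \<Longrightarrow> (u, v) \<in> E \<Longrightarrow> lab u = lab v"
    "\<And>v w. v \<in> R \<Longrightarrow> (v, w) \<in> E \<Longrightarrow> w \<notin> lab v"
proof -
  \<comment> \<open>The choice depends on \<open>v\<close> only through its component, hence is
    constant along edges.\<close>
  define lab where "lab = (\<lambda>v. SOME X. X \<in> \<X> \<and> \<not> adj E (comp_of E R v) X)"
  have lab: "lab v \<in> \<X> \<and> \<not> adj E (comp_of E R v) (lab v)" if "v \<in> R" for v
  proof -
    have "\<not> full E \<X> (comp_of E R v)" using assms(2)[rule_format, OF comp_of_subset] .
    then have "\<exists>X. X \<in> \<X> \<and> \<not> adj E (comp_of E R v) X"
      using conn_comp_of[OF assms(1) that] by (auto simp: full_def)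
    then show ?thesis unfolding lab_def by (rule someI_ex)
  qed
  show thesis
  proof (rule that)
    fix u v assume uv: "u \<in> R" "v \<in> R" "(u, v) \<in> E"
    have "v \<in> comp_of E R u" using comp_of_closed[OF comp_of_self[OF uv(1)] uv(3,2)] .
    then have "comp_of E R v = comp_of E R u" by (rule comp_of_eq[OF assms(1)])
    then show "lab u = lab v" by (simp add: lab_def)
  next
    fix v w assume vw: "v \<in> R" "(v, w) \<in> E"
    then show "w \<notin> lab v" using lab[OF vw(1)] comp_of_self[OF vw(1)] by (auto simp: adj_def)
  qed (use lab in auto)
qed

locale excluded_K_star =
  fixes G :: "'a pair_pre_digraph" and T :: "'x pair_pre_digraph" and W s t
  assumes graph: "pair_graph G" and td: "tree_decomposition G T W"
    and mf: "minor_free (K_star s t) G" and s: "1 \<le> s" and t: "2 \<le> t"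
begin

abbreviation "V \<equiv> pverts G"
abbreviation "E \<equiv> parcs G"

lemma sym_E: "sym E"
proof -
  interpret pair_graph G by (rule graph)
  show ?thesis using pair_sym_arcs by (simp add: symmetric_def)
qed

lemma finite_V: "finite V"
proof -
  interpret pair_graph G by (rule graph)
  show ?thesis by (rule pair_finite_verts)
qed

lemma E_sym: "(u, v) \<in> E \<Longrightarrow> (v, u) \<in> E"
  using sym_E by (rule symD)

section \<open>Roots, branch sets and the excluded minor\<close>

definition few_bags :: "'a set \<Rightarrow> bool" where
  "few_bags S \<longleftrightarrow> (\<exists>X\<subseteq>pverts T. card X \<le> t - 1 \<and> S \<subseteq> (\<Union>x\<in>X. W x))"

text \<open>
  The set \<open>Y\<close> is still to be partitioned. The parts in \<open>\<X>\<close> need not be connected; what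
  counts is that they extend to the branch sets \<open>B X\<close> of a complete minor outside \<open>Y\<close>.
\<close>

definition rooted :: "'a set set \<Rightarrow> ('a set \<Rightarrow> 'a set) \<Rightarrow> 'a set \<Rightarrow> bool" where
  "rooted \<X> B Y \<longleftrightarrow> finite \<X> \<and> card \<X> \<le> s \<and> Y \<subseteq> V \<and>
     (\<forall>X\<in>\<X>. X \<noteq> {} \<and> X \<subseteq> B X \<and> B X \<subseteq> V \<and> conn E (B X) \<and> B X \<inter> Y = {}) \<and>
     (\<forall>X\<in>\<X>. \<forall>X'\<in>\<X>. X \<noteq> X' \<longrightarrow> B X \<inter> B X' = {} \<and> adj E (B X) (B X')) \<and>
     (\<forall>u\<in>Y. \<forall>v. (u, v) \<in> E \<longrightarrow> v \<in> Y \<union> \<Union>\<X>)"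

lemma rootedD:
  assumes "rooted \<X> B Y"
  shows "finite \<X>" "card \<X> \<le> s" "Y \<subseteq> V"
    "X \<in> \<X> \<Longrightarrow> X \<noteq> {}" "X \<in> \<X> \<Longrightarrow> X \<subseteq> B X" "X \<in> \<X> \<Longrightarrow> B X \<subseteq> V"
    "X \<in> \<X> \<Longrightarrow> conn E (B X)" "X \<in> \<X> \<Longrightarrow> B X \<inter> Y = {}"
    "X \<in> \<X> \<Longrightarrow> X' \<in> \<X> \<Longrightarrow> X \<noteq> X' \<Longrightarrow> B X \<inter> B X' = {}"
    "X \<in> \<X> \<Longrightarrow> X' \<in> \<X> \<Longrightarrow> X \<noteq> X' \<Longrightarrow> adj E (B X) (B X')"
    "u \<in> Y \<Longrightarrow> (u, v) \<in> E \<Longrightarrow> v \<in> Y \<union> \<Union>\<X>"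
proof -
  show "u \<in> Y \<Longrightarrow> (u, v) \<in> E \<Longrightarrow> v \<in> Y \<union> \<Union>\<X>"
    using assms unfolding rooted_def by (elim conjE) blast
qed (use assms in \<open>simp_all add: rooted_def\<close>)

lemma rooted_finite: "rooted \<X> B Y \<Longrightarrow> finite Y"
  by (rule finite_subset[OF rootedD(3) finite_V])

text \<open>The branch sets \<open>B X\<close> would form the clique side and \<open>t\<close>
  disjoint full sets the independent side of a model of \<open>K_star s t\<close>.\<close>

lemma few_disjoint_full:
  assumes r: "rooted \<X> B Y" and "card \<X> = s"
    and "finite \<Z>" "disjoint \<Z>" "\<forall>Z\<in>\<Z>. Z \<subseteq> Y \<and> full E \<X> Z"
  shows "card \<Z> < t"
proof (rule ccontr)
  assume "\<not> card \<Z> < t"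
  then obtain \<Z>' where Z': "\<Z>' \<subseteq> \<Z>" "card \<Z>' = t" "finite \<Z>'"
    by (meson linorder_not_less obtain_subset_with_card_n)
  obtain f where f: "bij_betw f {..<s} \<X>"
    using ex_bij_betw_nat_finite[OF rootedD(1)[OF r]] assms(2) by (auto simp: atLeast0LessThan)
  obtain g where g: "bij_betw g {..<t} \<Z>'"
    using ex_bij_betw_nat_finite[OF Z'(3)] Z'(2) by (auto simp: atLeast0LessThan)
  have fX: "f i \<in> \<X>" if "i < s" for i using f that by (auto simp: bij_betw_def)
  have fne: "f i \<noteq> f j" if "i < s" "j < s" "i \<noteq> j" for i j
    using f that by (auto simp: bij_betw_def inj_on_def)
  have gZ: "g i \<in> \<Z>" if "i < t" for i using g Z'(1) that by (auto simp: bij_betw_def)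
  have gd: "g i \<inter> g j = {}" if "i < t" "j < t" "i \<noteq> j" for i j
  proof -
    have "g i \<noteq> g j" using g that by (auto simp: bij_betw_def inj_on_def)
    then show ?thesis using assms(4) gZ that by (auto simp: pairwise_def disjnt_def)
  qed
  have gY: "g i \<subseteq> Y" "full E \<X> (g i)" if "i < t" for i using assms(5) gZ[OF that] by auto
  have gB: "adj E (g j) (B (f i))" if "i < s" "j < t" for i j
    using gY(2)[OF that(2)] fX[OF that(1)] rootedD(5)[OF r fX[OF that(1)]]
    by (auto simp: full_def intro: adj_mono)
  define M where "M = case_sum (\<lambda>i. B (f i)) g"
  have vK: "pverts (K_star s t) = Inl ` {..<s} \<union> Inr ` {..<t}"
    by (simp add: K_star_def Let_def)
  have aK: "parcs (K_star s t) = (Inl ` {..<s} \<times> Inl ` {..<s} - Id) \<union>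
      Inl ` {..<s} \<times> Inr ` {..<t} \<union> Inr ` {..<t} \<times> Inl ` {..<s}"
    by (simp add: K_star_def Let_def)
  have 1: "M u \<subseteq> V \<and> connected (with_proj G \<restriction> M u)" if "u \<in> pverts (K_star s t)" for u
  proof -
    have "B (f i) \<subseteq> V \<and> conn E (B (f i))" if "i < s" for i
      using rootedD(6,7)[OF r fX[OF that]] by simp
    moreover have "g i \<subseteq> V \<and> conn E (g i)" if "i < t" for i
      using gY[OF that] rootedD(3)[OF r] unfolding full_def by auto
    ultimately show ?thesis
      using that unfolding vK M_def connected_induce_iff_conn[OF sym_E] by (elim UnE imageE) simp_all
  qed
  have 2: "M u \<inter> M v = {}" if "u \<in> pverts (K_star s t)" "v \<in> pverts (K_star s t)" "u \<noteq> v" for u v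
  proof -
    have *: "B (f i) \<inter> g j = {}" if "i < s" "j < t" for i j
      using rootedD(8)[OF r fX[OF that(1)]] gY(1)[OF that(2)] by auto
    have **: "B (f i) \<inter> B (f j) = {}" if "i < s" "j < s" "i \<noteq> j" for i j
      using rootedD(9)[OF r fX[OF that(1)] fX[OF that(2)] fne[OF that]] .
    have ***: "g j \<inter> B (f i) = {}" if "i < s" "j < t" for i j
      using *[OF that] by auto
    show ?thesis using that(1,2) unfolding vK M_def
      using that(3) by (elim UnE imageE) (simp_all add: ** gd * ***)
  qed
  have 3: "adj E (M u) (M v)" if "(u, v) \<in> parcs (K_star s t)" for u v
  proof -
    have a: "adj E (B (f i)) (B (f j))" if "i < s" "j < s" "i \<noteq> j" for i j
      using rootedD(10)[OF r fX[OF that(1)] fX[OF that(2)] fne[OF that]] .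
    have b: "adj E (B (f i)) (g j)" if "i < s" "j < t" for i j
      using gB[OF that] sym_E by (rule adj_sym[rotated])
    show ?thesis using that unfolding aK M_def by (auto intro: a b gB)
  qed
  have "minor_model (K_star s t) G M"
    unfolding minor_model_def using 1 2 3 by (auto simp: adj_def)
  then show False using mf by (auto simp: minor_free_def is_minor_def)
qed

section \<open>Separators of full sets\<close>

text \<open>
  If \<open>\<X>\<close> has fewer than \<open>s\<close> members, a single bag suffices: \<open>S\<close> is its intersection with
  a connected set \<open>Q\<close> below it, and \<open>Q\<close> itself is the branch set of the new part towards
  the full components \<open>D\<close> of \<open>Y - Q\<close>.
\<close>

lemma exists_separator:
  assumes r: "rooted \<X> B Y" and Z0: "Z0 \<subseteq> Y" "full E \<X> Z0"
  obtains D S Q where "separates E \<X> Y D S" "few_bags S" "D \<subseteq> Y"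
    "\<forall>d\<in>D. \<exists>Z\<subseteq>D. d \<in> Z \<and> full E \<X> Z" "full E \<X> Q" "Q \<subseteq> Y - D"
    "card \<X> < s \<longrightarrow> S \<subseteq> Q" "card \<X> = s \<longrightarrow> D = {}"
proof (cases "card \<X> = s")
  case True
  obtain \<Z> X where Z: "finite \<Z>" "disjoint \<Z>" "\<forall>Z\<in>\<Z>. Z \<subseteq> Y \<and> full E \<X> Z"
    and X: "X \<subseteq> pverts T" "card X \<le> card \<Z>" "\<forall>Z\<subseteq>Y. full E \<X> Z \<longrightarrow> Z \<inter> (\<Union>x\<in>X. W x) \<noteq> {}"
    using disjoint_or_hitting[OF graph td rootedD(3)[OF r], of "full E \<X>"] by (auto simp: full_def)
  have "card X \<le> t - 1" using few_disjoint_full[OF r True Z] X(2) by simp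
  then have fb: "few_bags (Y \<inter> (\<Union>x\<in>X. W x))" unfolding few_bags_def using X(1) by blast
  show thesis
  \<comment> \<open>No region is cut off here, and \<open>Q\<close> need only be full, so
    \<open>Z0\<close> will do.\<close>
  proof (rule that[of "{}" "Y \<inter> (\<Union>x\<in>X. W x)" Z0])
    show "separates E \<X> Y {} (Y \<inter> (\<Union>x\<in>X. W x))"
      unfolding separates_def using X(3) by blast
  qed (use Z0 True fb in auto)
next
  case False
  obtain x U where x: "x \<in> pverts T"
      "\<And>u v. u \<in> U \<Longrightarrow> u \<notin> W x \<Longrightarrow> (u, v) \<in> E \<Longrightarrow> v \<in> U"
      and ex: "\<exists>Z\<subseteq>Y \<inter> U. full E \<X> Z" and no: "\<not> (\<exists>Z\<subseteq>Y \<inter> U - W x. full E \<X> Z)"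
    using deepest_bag[where F = "full E \<X>", OF graph td rootedD(3)[OF r] _ Z0] full_def by metis
  obtain Z1 where Z1: "Z1 \<subseteq> Y \<inter> U" "full E \<X> Z1" using ex by auto
  obtain z where z: "z \<in> Z1" using Z1(2) by (auto simp: full_def conn_def)
  define Q where "Q = comp_of E (Y \<inter> U) z"
  have zYU: "z \<in> Y \<inter> U" using z Z1 by auto
  have Z1Q: "Z1 \<subseteq> Q"
    unfolding Q_def using Z1 z comp_of_self[OF zYU]
    by (intro conn_subset_comp_of) (auto simp: full_def)
  have Q: "conn E Q" "Q \<subseteq> Y \<inter> U"
    unfolding Q_def by (rule conn_comp_of[OF sym_E zYU], rule comp_of_subset)
  have fullQ: "full E \<X> Q" using Z1(2) Q(1) Z1Q by (auto simp: full_def intro: adj_mono)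
  \<comment> \<open>Within \<open>Y\<close>, edges leave \<open>Q\<close> only from
    \<open>W x\<close>, because \<open>W x\<close> bounds \<open>U\<close> and \<open>Q\<close> is a
    component of \<open>Y \<inter> U\<close>.\<close>
  have leave: "v \<in> Q" if "u \<in> Q" "u \<notin> W x" "(u, v) \<in> E" "v \<in> Y" for u v
    using that x(2)[of u v] Q(2) comp_of_closed[of u E "Y \<inter> U" z v] unfolding Q_def by blast
  define S where "S = Q \<inter> W x"
  define D where "D = {d \<in> Y - Q. full E \<X> (comp_of E (Y - Q) d)}"
  have Dc: "comp_of E (Y - Q) d \<subseteq> D" if "d \<in> D" for d
  proof
    fix w assume w: "w \<in> comp_of E (Y - Q) d"
    then have "comp_of E (Y - Q) w = comp_of E (Y - Q) d" by (rule comp_of_eq[OF sym_E])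
    then show "w \<in> D" using that w comp_of_subset[of E "Y - Q" d] unfolding D_def by auto
  qed
  show thesis
  proof (rule that[of D S Q])
    show "separates E \<X> Y D S"
      unfolding separates_def
    proof (intro conjI ballI allI impI)
      show "S \<subseteq> Y" using Q(2) by (auto simp: S_def)
      show "D \<inter> S = {}" by (auto simp: S_def D_def)
      fix u v assume uv: "u \<in> D" "v \<in> Y" "(u, v) \<in> E"
      then have u: "u \<in> Y - Q" by (auto simp: D_def)
      show "v \<in> D \<union> S"
      proof (cases "v \<in> Q")
        case True
        then have "v \<in> W x" using leave[OF True _ E_sym[OF uv(3)]] u by auto
        then show ?thesis using True by (auto simp: S_def)
      next
        case False
        then have "v \<in> comp_of E (Y - Q) u"
          using comp_of_closed[OF comp_of_self[OF u] uv(3)] uv(2) by auto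
        then show ?thesis using Dc[OF uv(1)] by auto
      qed
    next
      fix Z assume Z: "Z \<subseteq> Y - S - D"
      show "\<not> full E \<X> Z"
      proof
        assume fZ: "full E \<X> Z"
        then have cZ: "conn E Z" by (simp add: full_def)
        show False
        proof (cases "Z \<inter> Q = {}")
          case False
          then obtain q where q: "q \<in> Z" "q \<in> Q" by auto
          \<comment> \<open>As \<open>Z\<close> avoids \<open>S\<close>, it cannot pass through
            \<open>W x\<close> and stays in \<open>Q\<close>; but no full set lies in
            \<open>Y \<inter> U - W x\<close>.\<close>
          have "Z \<subseteq> Q - W x"
            by (rule conn_subset_closed[OF cZ q(1)]) (use q Z leave in \<open>auto simp: S_def\<close>)
          then have "Z \<subseteq> Y \<inter> U - W x" using Q(2) by auto
          then show False using no fZ by auto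
        next
          case True
          obtain d where d: "d \<in> Z" using cZ by (auto simp: conn_def)
          have dY: "d \<in> Y - Q" and ZY: "Z \<subseteq> Y - Q" using d True Z by auto
          \<comment> \<open>A full set off \<open>Q\<close> makes its whole component of
            \<open>Y - Q\<close> full, and such components were put into \<open>D\<close>.\<close>
          have sub: "Z \<subseteq> comp_of E (Y - Q) d"
            using cZ ZY d comp_of_self[OF dY] by (rule conn_subset_comp_of)
          have "full E \<X> (comp_of E (Y - Q) d)"
            using fZ conn_comp_of[OF sym_E dY] sub by (auto simp: full_def intro: adj_mono)
          then show False using d dY Z by (auto simp: D_def)
        qed
      qed
    qed
    have "card {x} \<le> t - 1" using t by simp
    moreover have "S \<subseteq> (\<Union>x\<in>{x}. W x)" by (simp add: S_def)
    ultimately show "few_bags S" unfolding few_bags_def using x(1) by blast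
    show "\<forall>d\<in>D. \<exists>Z\<subseteq>D. d \<in> Z \<and> full E \<X> Z"
    proof
      fix d assume d: "d \<in> D"
      then show "\<exists>Z\<subseteq>D. d \<in> Z \<and> full E \<X> Z"
        by (intro exI[of _ "comp_of E (Y - Q) d"]) (use Dc[OF d] comp_of_self[of d "Y - Q" E] in \<open>auto simp: D_def\<close>)
    qed
  qed (use fullQ Q(2) False in \<open>auto simp: D_def S_def\<close>)
qed

text \<open>Minimality is taken for fixed \<open>D\<close> among subsets of the \<open>S\<close>
  already found, so the bag bound and \<open>S \<subseteq> Q\<close> survive. Non-emptiness comes
  from \<open>Q\<close>, a full set outside \<open>D\<close> that has to be met.\<close>

lemma exists_minimal_separator:
  assumes r: "rooted \<X> B Y" and Z0: "Z0 \<subseteq> Y" "full E \<X> Z0"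
  obtains D S Q where "separates E \<X> Y D S" "\<And>S'. S' \<subset> S \<Longrightarrow> \<not> separates E \<X> Y D S'"
    "S \<noteq> {}" "few_bags S" "D \<subseteq> Y"
    "\<forall>d\<in>D. \<exists>Z\<subseteq>D. d \<in> Z \<and> full E \<X> Z" "full E \<X> Q" "Q \<subseteq> Y - D"
    "card \<X> < s \<longrightarrow> S \<subseteq> Q" "card \<X> = s \<longrightarrow> D = {}"
proof -
  obtain D S Q where *: "separates E \<X> Y D S" "few_bags S" "D \<subseteq> Y"
    "\<forall>d\<in>D. \<exists>Z\<subseteq>D. d \<in> Z \<and> full E \<X> Z" "full E \<X> Q" "Q \<subseteq> Y - D"
    "card \<X> < s \<longrightarrow> S \<subseteq> Q" "card \<X> = s \<longrightarrow> D = {}"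
    using exists_separator[OF r Z0] .
  have fin: "finite S"
    using *(1) rooted_finite[OF r] by (auto simp: separates_def intro: finite_subset)
  obtain S' where S': "S' \<subseteq> S \<and> separates E \<X> Y D S'"
    "\<And>S''. S'' \<subseteq> S \<and> separates E \<X> Y D S'' \<Longrightarrow> card S' \<le> card S''"
    using ex_has_least_nat[of "\<lambda>S'. S' \<subseteq> S \<and> separates E \<X> Y D S'" S card] *(1) by auto
  show thesis
  proof (rule that[of D S' Q])
    show "\<not> separates E \<X> Y D S''" if "S'' \<subset> S'" for S''
    proof
      assume "separates E \<X> Y D S''"
      then have "card S' \<le> card S''" using S' that by auto
      moreover have "card S'' < card S'" using that S'(1) fin by (meson psubset_card_mono finite_subset)
      ultimately show False by simp
    qed
    show "S' \<noteq> {}"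
    proof
      assume "S' = {}"
      then have "\<not> full E \<X> Q" using S'(1) *(6) by (simp add: separates_def)
      then show False using *(5) by simp
    qed
    obtain X where "X \<subseteq> pverts T" "card X \<le> t - 1" "S \<subseteq> (\<Union>x\<in>X. W x)"
      using *(2) unfolding few_bags_def by (elim exE conjE)
    then show "few_bags S'" using S'(1) unfolding few_bags_def by (intro exI[of _ X]) auto
  qed (use * S'(1) in auto)
qed

text \<open>
  Minimality of \<open>S\<close> is what connects the new part to \<open>X\<close>: a component \<open>L\<close> of \<open>Y - D\<^sub>X\<close> that
  meets \<open>S\<close> but has no edge to \<open>X\<close> could be removed from \<open>S\<close>.
\<close>

lemma minimal_separator_adj:
  assumes sep: "separates E \<X> Y D S" and min: "\<And>S'. S' \<subset> S \<Longrightarrow> \<not> separates E \<X> Y D S'"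
    and D: "D \<subseteq> Y" "\<forall>d\<in>D. \<exists>Z\<subseteq>D. d \<in> Z \<and> full E \<X> Z" and X: "X \<in> \<X>"
    and DX: "DX \<subseteq> Y - S - D"
    and cl: "\<And>u v. u \<in> DX \<Longrightarrow> (u, v) \<in> E \<Longrightarrow> v \<in> Y - S - D \<Longrightarrow> v \<in> DX"
    and nadj: "\<not> adj E DX X" and v: "v \<in> S"
  shows "adj E (comp_of E (Y - DX) v) X"
proof (rule ccontr)
  let ?L = "comp_of E (Y - DX) v"
  assume nL: "\<not> adj E ?L X"
  have SY: "S \<subseteq> Y" "D \<inter> S = {}" using sep by (auto simp: separates_def)
  have vY: "v \<in> Y - DX" using v SY DX by auto
  \<comment> \<open>Each vertex of \<open>D\<close> lies in a full subset of \<open>D\<close>; if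
    \<open>?L\<close> met \<open>D\<close>, it would absorb one and thus touch
    \<open>X\<close>.\<close>
  have LD: "?L \<inter> D = {}"
  proof (rule ccontr)
    assume "?L \<inter> D \<noteq> {}"
    then obtain d where d: "d \<in> ?L" "d \<in> D" by auto
    then obtain Z where Z: "Z \<subseteq> D" "d \<in> Z" "full E \<X> Z" using D(2) by blast
    have "Z \<subseteq> ?L" using Z d(1) D(1) DX by (intro conn_subset_comp_of[of E Z _ d]) (auto simp: full_def)
    then have "adj E ?L X" using Z(3) X by (auto simp: full_def intro: adj_mono)
    then show False using nL by simp
  qed
  have "S - ?L \<subset> S" using v comp_of_self[OF vY] by auto
  moreover have "separates E \<X> Y D (S - ?L)"
    unfolding separates_def
  proof (intro conjI ballI allI impI)
    show "S - ?L \<subseteq> Y" "D \<inter> (S - ?L) = {}" using SY by auto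
    fix a b assume ab: "a \<in> D" "b \<in> Y" "(a, b) \<in> E"
    have "b \<in> D \<union> S" using sep ab by (auto simp: separates_def)
    moreover have "b \<notin> ?L"
      using comp_of_closed[of b E "Y - DX" v a] E_sym[OF ab(3)] ab D(1) DX LD by blast
    ultimately show "b \<in> D \<union> (S - ?L)" by auto
  next
    fix Z assume Z: "Z \<subseteq> Y - (S - ?L) - D"
    show "\<not> full E \<X> Z"
    proof
      assume fZ: "full E \<X> Z"
      show False
      proof (cases "Z \<inter> (DX \<union> ?L) = {}")
        case True
        then have "Z \<subseteq> Y - S - D" using Z by auto
        then show False using sep fZ by (auto simp: separates_def)
      next
        case False
        then obtain z where z: "z \<in> Z" "z \<in> DX \<union> ?L" by auto
        \<comment> \<open>\<open>DX\<close> is closed in \<open>Y - S - D\<close> and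
          \<open>?L\<close> in \<open>Y - DX\<close>, so \<open>Z\<close> is stuck in their union,
          neither half of which is adjacent to \<open>X\<close>.\<close>
        have "Z \<subseteq> DX \<union> ?L"
        proof (rule conn_subset_closed[of E Z z])
          fix a b assume ab: "a \<in> DX \<union> ?L" "a \<in> Z" "b \<in> Z" "(a, b) \<in> E"
          show "b \<in> DX \<union> ?L"
          proof (cases "a \<in> DX")
            case True
            then show ?thesis using cl[OF True ab(4)] ab(3) Z by auto
          next
            case False
            then show ?thesis using comp_of_closed[of a E "Y - DX" v b] ab Z by blast
          qed
        qed (use fZ z in \<open>auto simp: full_def\<close>)
        then have "adj E (DX \<union> ?L) X" using fZ X by (auto simp: full_def intro: adj_mono)
        then show False using nL nadj by (auto simp: adj_def)
      qed
    qed
  qed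
  ultimately show False using min by blast
qed

section \<open>Handing roots and branch sets on to the pieces\<close>

text \<open>\<open>N\<close> is the branch set of the new part \<open>S\<close>, which need not be
  connected itself. Replacing a root and adding one are both instances.\<close>

lemma rooted_insert:
  assumes r: "rooted \<X> B Y" and "\<X>' \<subseteq> \<X>" and D: "D \<subseteq> Y" and S: "S \<noteq> {}" "S \<subseteq> Y" "S \<subseteq> N"
    and N: "N \<subseteq> V" "conn E N" "N \<inter> D = {}"
    and NX: "\<And>X. X \<in> \<X>' \<Longrightarrow> N \<inter> B X = {}" "\<And>X. X \<in> \<X>' \<Longrightarrow> adj E N (B X)"
    and "card (insert S \<X>') \<le> s"
    and nb: "\<And>u v. u \<in> D \<Longrightarrow> (u, v) \<in> E \<Longrightarrow> v \<in> D \<union> \<Union>(insert S \<X>')"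
  shows "\<exists>B'. rooted (insert S \<X>') B' D"
proof -
  define B' where "B' = B(S := N)"
  \<comment> \<open>\<open>S\<close> is a non-empty subset of \<open>Y\<close>, which the old branch
    sets avoid, so overriding \<open>B\<close> at \<open>S\<close> leaves the others intact.\<close>
  have SX: "X \<noteq> S" if "X \<in> \<X>'" for X
    using rootedD(5,8)[OF r, of X] that assms(2) S by auto
  have B'S: "B' S = N" by (simp add: B'_def)
  have B'o: "B' X = B X" if "X \<in> \<X>'" for X using SX[OF that] by (simp add: B'_def)
  have "rooted (insert S \<X>') B' D"
    unfolding rooted_def
  proof (intro conjI ballI allI impI)
    show "finite (insert S \<X>')" using rootedD(1)[OF r] assms(2) finite_subset by auto
    show "card (insert S \<X>') \<le> s" by fact
    show "D \<subseteq> V" using D rootedD(3)[OF r] by auto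
  next
    fix X assume X: "X \<in> insert S \<X>'"
    have "X \<noteq> {} \<and> X \<subseteq> B' X \<and> B' X \<subseteq> V \<and> conn E (B' X) \<and> B' X \<inter> D = {}"
    proof (cases "X = S")
      case True
      then show ?thesis using S N B'S by simp
    next
      case False
      then have X: "X \<in> \<X>'" "X \<in> \<X>" using X assms(2) by auto
      show ?thesis using rootedD(4-8)[OF r X(2)] B'o[OF X(1)] D by auto
    qed
    then show "X \<noteq> {}" "X \<subseteq> B' X" "B' X \<subseteq> V" "conn E (B' X)" "B' X \<inter> D = {}" by blast+
  next
    fix X1 X2 assume X12: "X1 \<in> insert S \<X>'" "X2 \<in> insert S \<X>'" "X1 \<noteq> X2"
    consider "X1 = S" "X2 \<in> \<X>'" | "X2 = S" "X1 \<in> \<X>'" | "X1 \<in> \<X>'" "X2 \<in> \<X>'" using X12 by auto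
    then have "B' X1 \<inter> B' X2 = {} \<and> adj E (B' X1) (B' X2)"
    proof cases
      case 1
      then show ?thesis using NX[of X2] B'S B'o[of X2] by simp
    next
      case 2
      then show ?thesis
        using NX(1)[of X1] adj_sym[OF sym_E NX(2)[of X1]] B'S B'o[of X1] by (simp add: Int_commute)
    next
      case 3
      then show ?thesis using rootedD(9,10)[OF r, of X1 X2] X12(3) assms(2) B'o by auto
    qed
    then show "B' X1 \<inter> B' X2 = {}" "adj E (B' X1) (B' X2)" by simp_all
  qed (rule nb)
  then show ?thesis by blast
qed

text \<open>The branch set of \<open>S\<close> is \<open>B X\<close> plus the components of
  \<open>Y - DX\<close> meeting \<open>S\<close>. Minimality attaches each of these to
  \<open>X\<close>, and \<open>B X\<close> supplies the edges to the other branch sets.\<close>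

lemma rooted_exchange:
  assumes r: "rooted \<X> B Y" and sep: "separates E \<X> Y D S"
    and min: "\<And>S'. S' \<subset> S \<Longrightarrow> \<not> separates E \<X> Y D S'" and S: "S \<noteq> {}"
    and D: "D \<subseteq> Y" "\<forall>d\<in>D. \<exists>Z\<subseteq>D. d \<in> Z \<and> full E \<X> Z" and X: "X \<in> \<X>"
    and DX: "DX \<subseteq> Y - S - D"
    and cl: "\<And>u v. u \<in> DX \<Longrightarrow> (u, v) \<in> E \<Longrightarrow> v \<in> Y - S - D \<Longrightarrow> v \<in> DX"
    and nadj: "\<not> adj E DX X"
  shows "\<exists>B'. rooted (insert S (\<X> - {X})) B' DX"
proof -
  define C where "C = (\<Union>v\<in>S. comp_of E (Y - DX) v)"
  have SY: "S \<subseteq> Y" using sep by (simp add: separates_def)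
  have SYD: "v \<in> Y - DX" if "v \<in> S" for v using that SY DX by auto
  have SC: "S \<subseteq> C" using comp_of_self[OF SYD] by (auto simp: C_def)
  have CY: "C \<subseteq> Y - DX" unfolding C_def using comp_of_subset by (rule UN_least)
  have conn: "conn E (B X \<union> C)" unfolding C_def
  proof (rule conn_UN_adj[OF sym_E rootedD(7)[OF r X]])
    fix v assume v: "v \<in> S"
    show "conn E (comp_of E (Y - DX) v)" by (rule conn_comp_of[OF sym_E SYD[OF v]])
    have "adj E (comp_of E (Y - DX) v) X"
      by (rule minimal_separator_adj[OF sep min D X DX cl nadj v])
    then show "B X \<inter> comp_of E (Y - DX) v \<noteq> {} \<or> adj E (comp_of E (Y - DX) v) (B X)"
      using rootedD(5)[OF r X] by (auto intro: adj_mono)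
  qed
  show ?thesis
  proof (rule rooted_insert[OF r, where N = "B X \<union> C"])
    have "card (insert S (\<X> - {X})) \<le> Suc (card (\<X> - {X}))" by (rule card_insert_le_m1) simp_all
    also have "\<dots> = card \<X>" using card_Suc_Diff1[OF rootedD(1)[OF r] X] .
    finally show "card (insert S (\<X> - {X})) \<le> s" using rootedD(2)[OF r] by simp
    show "B X \<union> C \<subseteq> V" using CY rootedD(3)[OF r] rootedD(6)[OF r X] by auto
    show "(B X \<union> C) \<inter> DX = {}" using CY rootedD(8)[OF r X] DX by auto
  next
    fix X' assume "X' \<in> \<X> - {X}"
    then have X': "X' \<in> \<X>" "X \<noteq> X'" by auto
    show "(B X \<union> C) \<inter> B X' = {}" using rootedD(8)[OF r X'(1)] rootedD(9)[OF r X X'] CY by auto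
    show "adj E (B X \<union> C) (B X')" using rootedD(10)[OF r X X'] by (rule adj_mono) auto
  next
    fix u v assume uv: "u \<in> DX" "(u, v) \<in> E"
    \<comment> \<open>Otherwise \<open>u\<close>, a neighbour of \<open>D\<close> in
      \<open>Y\<close>, would lie in \<open>D \<union> S\<close>.\<close>
    have "v \<notin> D"
    proof
      assume "v \<in> D"
      then have "u \<in> D \<union> S" using sep uv(1) DX E_sym[OF uv(2)] unfolding separates_def by blast
      then show False using uv(1) DX by auto
    qed
    moreover have "v \<in> Y \<union> \<Union>\<X>" using rootedD(11)[OF r _ uv(2)] uv(1) DX by auto
    moreover have "v \<notin> X" using nadj uv by (auto simp: adj_def)
    ultimately show "v \<in> DX \<union> \<Union>(insert S (\<X> - {X}))" using cl[OF uv] by auto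
  qed (use S SY SC conn DX in auto)
qed

text \<open>Fullness gives \<open>Q\<close> its edges to all other branch sets, and fewer than
  \<open>s\<close> roots leave room for one more.\<close>

lemma rooted_extend:
  assumes r: "rooted \<X> B Y" and "card \<X> < s" and sep: "separates E \<X> Y D S" and S: "S \<noteq> {}"
    and D: "D \<subseteq> Y" and Q: "full E \<X> Q" "Q \<subseteq> Y - D" "S \<subseteq> Q"
  shows "\<exists>B'. rooted (insert S \<X>) B' D"
proof (rule rooted_insert[OF r, where N = Q])
  show "card (insert S \<X>) \<le> s" using assms(2) rootedD(1)[OF r] by (simp add: card_insert_if)
  show "S \<subseteq> Y" using sep by (simp add: separates_def)
  show "Q \<subseteq> V" using Q rootedD(3)[OF r] by auto
  show "conn E Q" using Q by (simp add: full_def)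
next
  fix X assume X: "X \<in> \<X>"
  show "Q \<inter> B X = {}" using Q rootedD(8)[OF r X] by auto
  have "adj E Q X" using Q(1) X by (simp add: full_def)
  then show "adj E Q (B X)" using rootedD(5)[OF r X] by (auto intro: adj_mono)
next
  fix u v assume uv: "u \<in> D" "(u, v) \<in> E"
  have "v \<in> Y \<union> \<Union>\<X>" using rootedD(11)[OF r _ uv(2)] uv(1) D by auto
  then show "v \<in> D \<union> \<Union>(insert S \<X>)" using sep uv by (auto simp: separates_def)
qed (use S D Q in auto)

text \<open>The outside neighbours of such a piece all lie in the other roots. Used when no full set
  is left.\<close>

lemma rooted_drop:
  assumes r: "rooted \<X> B Y" and X: "X \<in> \<X>" and DX: "DX \<subseteq> Y"
    and cl: "\<And>u v. u \<in> DX \<Longrightarrow> (u, v) \<in> E \<Longrightarrow> v \<in> Y \<Longrightarrow> v \<in> DX"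
    and nadj: "\<not> adj E DX X"
  shows "rooted (\<X> - {X}) B DX"
  unfolding rooted_def
proof (intro conjI ballI allI impI)
  show "finite (\<X> - {X})" using rootedD(1)[OF r] by simp
  have "card (\<X> - {X}) \<le> card \<X>" using rootedD(1)[OF r] by (simp add: card_mono)
  then show "card (\<X> - {X}) \<le> s" using rootedD(2)[OF r] by simp
  show "DX \<subseteq> V" using DX rootedD(3)[OF r] by auto
next
  fix u v assume uv: "u \<in> DX" "(u, v) \<in> E"
  have "v \<in> Y \<union> \<Union>\<X>" using rootedD(11)[OF r _ uv(2)] uv(1) DX by auto
  moreover have "v \<notin> X" using nadj uv by (auto simp: adj_def)
  ultimately show "v \<in> DX \<union> \<Union>(\<X> - {X})" using cl[OF uv] by auto
next
  fix X' assume "X' \<in> \<X> - {X}"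
  then have X': "X' \<in> \<X>" by simp
  show "X' \<noteq> {}" "X' \<subseteq> B X'" "B X' \<subseteq> V" "conn E (B X')"
    by (fact rootedD(4-7)[OF r X'])+
  show "B X' \<inter> DX = {}" using rootedD(8)[OF r X'] DX by auto
next
  fix X1 X2 assume "X1 \<in> \<X> - {X}" "X2 \<in> \<X> - {X}" "X1 \<noteq> X2"
  then show "B X1 \<inter> B X2 = {}" "adj E (B X1) (B X2)" using rootedD(9,10)[OF r, of X1 X2] by auto
qed

end

section \<open>Trees given by parent pointers\<close>

text \<open>Node 0 is the root. With parents preceding children, a leaf is added by setting
  \<open>par\<close> at \<open>n\<close>, and the older nodes stay as they are.\<close>

definition parent_tree :: "nat \<Rightarrow> (nat \<Rightarrow> nat) \<Rightarrow> nat pair_pre_digraph" where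
  "parent_tree n par = \<lparr>pverts = {..<n},
     parcs = {(i, j). i < n \<and> j < n \<and> (0 < i \<and> j = par i \<or> 0 < j \<and> i = par j)}\<rparr>"

lemma sym_parent_tree: "sym (parcs (parent_tree n par))"
  by (auto simp: parent_tree_def sym_def)

lemma pair_graph_parent_tree:
  assumes "\<And>i. 0 < i \<Longrightarrow> i < n \<Longrightarrow> par i < i"
  shows "pair_graph (parent_tree n par)"
proof
  show "finite (parcs (parent_tree n par))"
    by (rule finite_subset[of _ "{..<n} \<times> {..<n}"]) (auto simp: parent_tree_def)
  show "symmetric (with_proj (parent_tree n par))"
    using sym_parent_tree by (simp add: symmetric_def)
  show "fst e \<noteq> snd e" if "e \<in> parcs (parent_tree n par)" for e
    using that assms[of "fst e"] assms[of "snd e"] by (cases e) (auto simp: parent_tree_def)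
qed (auto simp: parent_tree_def)

text \<open>Parents are smaller, so climbing inside \<open>N\<close> ends, and it can end only at
  \<open>m\<close>.\<close>

lemma conn_parent_tree:
  assumes par: "\<And>i. 0 < i \<Longrightarrow> i < n \<Longrightarrow> par i < i" and N: "N \<subseteq> {..<n}" "m \<in> N"
    and up: "\<And>i. i \<in> N \<Longrightarrow> i \<noteq> m \<Longrightarrow> 0 < i \<and> par i \<in> N"
  shows "conn (parcs (parent_tree n par)) N"
proof (rule conn_from_root[OF sym_parent_tree N(2)])
  fix i assume "i \<in> N"
  then show "(m, i) \<in> rtrancl_on N (parcs (parent_tree n par))"
  proof (induction i rule: less_induct)
    case (less i)
    show ?case
    proof (cases "i = m")
      case True
      then show ?thesis using N by simp
    next
      case False
      then have i: "0 < i" "par i \<in> N" "i < n" using up less.prems N by auto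
      then have "(m, par i) \<in> rtrancl_on N (parcs (parent_tree n par))"
        using less.IH[of "par i"] par by simp
      moreover have "(par i, i) \<in> parcs (parent_tree n par)"
        using i N by (auto simp: parent_tree_def)
      ultimately show ?thesis using less.prems by (rule rtrancl_on_into_rtrancl_on)
    qed
  qed
qed

lemma pcas_nth:
  assumes "pcas u p v"
  shows "pawalk_verts u p ! 0 = u \<and> pawalk_verts u p ! length p = v \<and>
    (\<forall>i<length p. p ! i = (pawalk_verts u p ! i, pawalk_verts u p ! Suc i))"
  using assms
proof (induction p arbitrary: u)
  case (Cons e p)
  then have IH: "pawalk_verts (snd e) p ! 0 = snd e" "pawalk_verts (snd e) p ! length p = v"
    "\<forall>i<length p. p ! i = (pawalk_verts (snd e) p ! i, pawalk_verts (snd e) p ! Suc i)"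
    and e: "fst e = u" by auto
  show ?case
  proof (intro conjI allI impI)
    fix i assume "i < length (e # p)"
    then show "(e # p) ! i = (pawalk_verts u (e # p) ! i, pawalk_verts u (e # p) ! Suc i)"
      using IH e by (cases i) auto
  qed (use IH e in auto)
qed simp

text \<open>The largest vertex of a cycle would have its parent as both of its neighbours.\<close>

lemma undirected_tree_parent_tree:
  assumes "0 < n" and par: "\<And>i. 0 < i \<Longrightarrow> i < n \<Longrightarrow> par i < i"
  shows "undirected_tree (parent_tree n par)"
  unfolding undirected_tree_def
proof (intro conjI notI)
  let ?T = "parent_tree n par"
  show graph: "pair_graph ?T" using par by (rule pair_graph_parent_tree)
  interpret pair_graph ?T by (rule graph)
  have "conn (parcs ?T) {..<n}"
  proof (rule conn_parent_tree[where N = "{..<n}" and m = 0, OF par])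
    show "0 < i \<and> par i \<in> {..<n}" if "i \<in> {..<n}" "i \<noteq> 0" for i
      using par[of i] that by auto
  qed (use assms(1) in auto)
  moreover have "with_proj ?T \<restriction> {..<n} = with_proj ?T"
    by (auto simp: induce_subgraph_def with_proj_def parent_tree_def)
  ultimately show "connected (with_proj ?T)"
    using connected_induce_iff_conn[OF sym_parent_tree, of n par "{..<n}"] by simp
  assume "\<exists>p. cycle p \<and> 3 \<le> length p"
  then obtain p u where p: "awalk u p u" "distinct (tl (pawalk_verts u p))" "3 \<le> length p"
    by (auto simp: cycle_def)
  define vs where "vs = pawalk_verts u p"
  define k where "k = length p"
  have pc: "pcas u p u" "set p \<subseteq> parcs ?T" using p(1) by (auto simp: awalk_def)
  have len: "length vs = Suc k" using length_awalk_verts[of u p] by (simp add: vs_def k_def)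
  have vs_nth: "p ! i = (vs ! i, vs ! Suc i)" if "i < k" for i
    using pcas_nth[OF pc(1)] that by (auto simp: vs_def k_def)
  have k: "3 \<le> k" using p(3) by (simp add: k_def)
  have v0k: "vs ! 0 = vs ! k" using pcas_nth[OF pc(1)] by (simp add: vs_def k_def)
  have arc: "(vs ! i, vs ! Suc i) \<in> parcs ?T" if "i < k" for i
    using vs_nth[OF that] pc(2) nth_mem[of i p] that by (auto simp: k_def)
  \<comment> \<open>Index 0 is left out since the closed walk repeats its first vertex at index
    \<open>k\<close>.\<close>
  have inj: "i = j" if "1 \<le> i" "i \<le> k" "1 \<le> j" "j \<le> k" "vs ! i = vs ! j" for i j
  proof -
    have "tl vs ! (i - 1) = vs ! i" "tl vs ! (j - 1) = vs ! j"
      using that len by (simp_all add: nth_tl)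
    then have "i - 1 = j - 1"
      using p(2) that len nth_eq_iff_index_eq[of "tl vs" "i - 1" "j - 1"] by (simp add: vs_def)
    then show ?thesis using that by simp
  qed
  define m where "m = Max (set vs)"
  have ne: "vs \<noteq> []" using len by auto
  have le: "vs ! i \<le> m" if "i \<le> k" for i
    using that len by (auto simp: m_def intro!: Max_ge nth_mem)
  have "m \<in> set vs" using ne by (simp add: m_def)
  then obtain j0 where j0: "j0 \<le> k" "vs ! j0 = m"
    using len by (metis in_set_conv_nth less_Suc_eq_le)
  define j where "j = (if j0 = 0 then k else j0)"
  have j: "1 \<le> j" "j \<le> k" "vs ! j = m" using j0 k v0k by (auto simp: j_def)
  \<comment> \<open>The cyclic predecessor and successor of \<open>j\<close> among the indices 1 to
    \<open>k\<close>; they differ because \<open>3 \<le> k\<close>.\<close>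
  define q where "q = (if j = 1 then k else j - 1)"
  define q' where "q' = (if j = k then 1 else j + 1)"
  have qk: "q \<le> k" "q' \<le> k" using j k by (auto simp: q_def q'_def)
  have nb: "a = par m" if "(a, m) \<in> parcs ?T" "a \<le> m" for a
    using that par[of a] by (auto simp: parent_tree_def)
  have "(vs ! (j - 1), m) \<in> parcs ?T" using arc[of "j - 1"] j by simp
  moreover have "vs ! (j - 1) = vs ! q" using v0k by (simp add: q_def)
  ultimately have "(vs ! q, m) \<in> parcs ?T" by simp
  then have a: "vs ! q = par m" by (rule nb) (rule le[OF qk(1)])
  have "(m, vs ! q') \<in> parcs ?T"
    using arc[of j] arc[of 0] j k v0k by (auto simp: q'_def)
  then have "(vs ! q', m) \<in> parcs ?T" using sym_parent_tree by (rule symD[rotated])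
  then have b: "vs ! q' = par m" by (rule nb) (rule le[OF qk(2)])
  have "q = q'"
  proof (rule inj)
    show "1 \<le> q" "1 \<le> q'" using j k by (auto simp: q_def q'_def)
  qed (use qk a b in simp_all)
  then show False using j k by (auto simp: q_def q'_def split: if_splits)
qed

section \<open>Growing the tree decomposition of the quotient\<close>

context excluded_K_star
begin

text \<open>
  A partially built \<open>s\<close>-simple tree decomposition of the quotient. The fourth conjunct is what
  makes the set of bags containing a given part connected.
\<close>

definition config :: "nat \<Rightarrow> (nat \<Rightarrow> nat) \<Rightarrow> (nat \<Rightarrow> 'a set set) \<Rightarrow> bool" where
  "config n par \<beta> \<longleftrightarrow> 0 < n \<and>
     (\<forall>i. 0 < i \<and> i < n \<longrightarrow> par i < i) \<and>
     (\<forall>i<n. finite (\<beta> i) \<and> card (\<beta> i) \<le> Suc s) \<and>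
     (\<forall>i. 0 < i \<and> i < n \<longrightarrow> (\<forall>P\<in>\<beta> i. P \<in> \<beta> (par i) \<or> (\<forall>j<i. P \<notin> \<beta> j))) \<and>
     (\<forall>A. card A = s \<longrightarrow> card {i. i < n \<and> A \<subseteq> \<beta> i} \<le> 2) \<and>
     (\<forall>i<n. \<forall>P\<in>\<beta> i. P \<noteq> {} \<and> P \<subseteq> V \<and> few_bags P) \<and>
     (\<forall>i<n. \<forall>j<n. \<forall>P\<in>\<beta> i. \<forall>Q\<in>\<beta> j. P \<noteq> Q \<longrightarrow> P \<inter> Q = {})"

lemma configD:
  assumes "config n par \<beta>"
  shows "0 < n" "\<And>i. 0 < i \<Longrightarrow> i < n \<Longrightarrow> par i < i"
    "\<And>i. i < n \<Longrightarrow> finite (\<beta> i)" "\<And>i. i < n \<Longrightarrow> card (\<beta> i) \<le> Suc s"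
    "\<And>i P. 0 < i \<Longrightarrow> i < n \<Longrightarrow> P \<in> \<beta> i \<Longrightarrow> P \<in> \<beta> (par i) \<or> (\<forall>j<i. P \<notin> \<beta> j)"
    "\<And>A. card A = s \<Longrightarrow> card {i. i < n \<and> A \<subseteq> \<beta> i} \<le> 2"
    "\<And>i P. i < n \<Longrightarrow> P \<in> \<beta> i \<Longrightarrow> P \<noteq> {}" "\<And>i P. i < n \<Longrightarrow> P \<in> \<beta> i \<Longrightarrow> P \<subseteq> V"
    "\<And>i P. i < n \<Longrightarrow> P \<in> \<beta> i \<Longrightarrow> few_bags P"
    "\<And>i j P Q. i < n \<Longrightarrow> j < n \<Longrightarrow> P \<in> \<beta> i \<Longrightarrow> Q \<in> \<beta> j \<Longrightarrow> P \<noteq> Q \<Longrightarrow> P \<inter> Q = {}"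
proof -
  note c = assms[unfolded config_def]
  show "0 < n" using c by (elim conjE)
  show "\<And>i. 0 < i \<Longrightarrow> i < n \<Longrightarrow> par i < i" using c by (elim conjE) simp
  show "\<And>i. i < n \<Longrightarrow> finite (\<beta> i)" using c by (elim conjE) simp
  show "\<And>i. i < n \<Longrightarrow> card (\<beta> i) \<le> Suc s" using c by (elim conjE) simp
  show "\<And>i P. 0 < i \<Longrightarrow> i < n \<Longrightarrow> P \<in> \<beta> i \<Longrightarrow> P \<in> \<beta> (par i) \<or> (\<forall>j<i. P \<notin> \<beta> j)"
    using c by (elim conjE) blast
  show "\<And>A. card A = s \<Longrightarrow> card {i. i < n \<and> A \<subseteq> \<beta> i} \<le> 2" using c by (elim conjE) blast
  show "\<And>i P. i < n \<Longrightarrow> P \<in> \<beta> i \<Longrightarrow> P \<noteq> {}" "\<And>i P. i < n \<Longrightarrow> P \<in> \<beta> i \<Longrightarrow> P \<subseteq> V"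
    "\<And>i P. i < n \<Longrightarrow> P \<in> \<beta> i \<Longrightarrow> few_bags P" using c by ((elim conjE)?, blast)+
  show "\<And>i j P Q. i < n \<Longrightarrow> j < n \<Longrightarrow> P \<in> \<beta> i \<Longrightarrow> Q \<in> \<beta> j \<Longrightarrow> P \<noteq> Q \<Longrightarrow> P \<inter> Q = {}"
    by (rule c[THEN conjunct2, THEN conjunct2, THEN conjunct2, THEN conjunct2, THEN conjunct2,
          THEN conjunct2, rule_format])
qed

text \<open>Edges with just one end in \<open>Y\<close> count too, so a solved piece also accounts
  for its edges to the roots.\<close>

definition covered :: "'a set \<Rightarrow> nat \<Rightarrow> (nat \<Rightarrow> 'a set set) \<Rightarrow> bool" where
  "covered Y n \<beta> \<longleftrightarrow> (\<forall>u\<in>Y. (\<exists>i<n. \<exists>P\<in>\<beta> i. u \<in> P) \<and>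
     (\<forall>v. (u, v) \<in> E \<longrightarrow> (\<exists>i<n. \<exists>P\<in>\<beta> i. \<exists>Q\<in>\<beta> i. u \<in> P \<and> v \<in> Q)))"

lemma covered_extend:
  assumes "covered Y n \<beta>" "n \<le> n'" "\<And>i. i < n \<Longrightarrow> \<beta>' i = \<beta> i"
  shows "covered Y n' \<beta>'"
  unfolding covered_def
proof (intro ballI conjI allI impI)
  fix u assume u: "u \<in> Y"
  then obtain i P where "i < n" "P \<in> \<beta> i" "u \<in> P" using assms(1) unfolding covered_def by blast
  then show "\<exists>i<n'. \<exists>P\<in>\<beta>' i. u \<in> P" using assms(2,3) by (intro exI[of _ i]) auto
  fix v assume "(u, v) \<in> E"
  then obtain i P Q where "i < n" "P \<in> \<beta> i" "Q \<in> \<beta> i" "u \<in> P" "v \<in> Q"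
    using assms(1) u unfolding covered_def by blast
  then show "\<exists>i<n'. \<exists>P\<in>\<beta>' i. \<exists>Q\<in>\<beta>' i. u \<in> P \<and> v \<in> Q"
    using assms(2,3) by (intro exI[of _ i]) auto
qed

definition free_of :: "nat \<Rightarrow> (nat \<Rightarrow> 'a set set) \<Rightarrow> 'a set \<Rightarrow> bool" where
  "free_of n \<beta> Y \<longleftrightarrow> (\<forall>i<n. \<forall>P\<in>\<beta> i. P \<inter> Y = {})"

text \<open>
  The bound 1 on the number of bags containing an \<open>s\<close>-element \<open>\<X>\<close> leaves room for exactly one
  more such bag, the one attached for \<open>Y\<close>.
\<close>

definition solvable :: "'a set set \<Rightarrow> 'a set \<Rightarrow> bool" where
  "solvable \<X> Y \<longleftrightarrow> (\<forall>n par \<beta> p. config n par \<beta> \<longrightarrow> p < n \<longrightarrow> \<X> \<subseteq> \<beta> p \<longrightarrow> free_of n \<beta> Y \<longrightarrow>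
     (card \<X> = s \<longrightarrow> card {i. i < n \<and> \<X> \<subseteq> \<beta> i} \<le> 1) \<longrightarrow>
     (\<exists>n' par' \<beta>'. config n' par' \<beta>' \<and> n \<le> n' \<and> (\<forall>i<n. \<beta>' i = \<beta> i) \<and>
        (\<forall>i. n \<le> i \<and> i < n' \<longrightarrow> \<beta>' i \<subseteq> \<X> \<union> Pow Y) \<and> covered Y n' \<beta>'))"

section \<open>Attaching bags\<close>

text \<open>The pieces are solved one after another, each from bag \<open>p\<close>. Bags made for
  one piece consist of its roots and subsets of it; so they avoid the other pieces and, by the
  non-inclusion assumption, do not use up the allowance of another \<open>s\<close>-element root
  set.\<close>

lemma solve_family:
  assumes "finite I" "\<And>c. c \<in> I \<Longrightarrow> solvable (Xf c) (Yf c)"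
    and "\<And>c d. c \<in> I \<Longrightarrow> d \<in> I \<Longrightarrow> c \<noteq> d \<Longrightarrow> Yf c \<inter> Yf d = {}"
    and "\<And>c d. c \<in> I \<Longrightarrow> d \<in> I \<Longrightarrow> c \<noteq> d \<Longrightarrow> card (Xf d) = s \<Longrightarrow> \<not> Xf d \<subseteq> Xf c"
    and cfg: "config n par \<beta>" and p: "p < n" and "\<And>c. c \<in> I \<Longrightarrow> Xf c \<subseteq> \<beta> p"
    and "\<And>c. c \<in> I \<Longrightarrow> free_of n \<beta> (Yf c)"
    and "\<And>c. c \<in> I \<Longrightarrow> card (Xf c) = s \<Longrightarrow> card {i. i < n \<and> Xf c \<subseteq> \<beta> i} \<le> 1"
  shows "\<exists>n' par' \<beta>'. config n' par' \<beta>' \<and> n \<le> n' \<and> (\<forall>i<n. \<beta>' i = \<beta> i) \<and>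
        (\<forall>i. n \<le> i \<and> i < n' \<longrightarrow> (\<exists>c\<in>I. \<beta>' i \<subseteq> Xf c \<union> Pow (Yf c))) \<and> (\<forall>c\<in>I. covered (Yf c) n' \<beta>')"
  using assms(1-4,7-)
proof (induction I rule: finite_induct)
  case empty
  then show ?case using cfg by (intro exI[of _ n] exI[of _ par] exI[of _ \<beta>]) simp
next
  case (insert c I)
  have "\<exists>n' par' \<beta>'. config n' par' \<beta>' \<and> n \<le> n' \<and> (\<forall>i<n. \<beta>' i = \<beta> i) \<and>
        (\<forall>i. n \<le> i \<and> i < n' \<longrightarrow> (\<exists>c\<in>I. \<beta>' i \<subseteq> Xf c \<union> Pow (Yf c))) \<and> (\<forall>c\<in>I. covered (Yf c) n' \<beta>')"
    by (rule insert.IH) (use insert.prems in auto)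
  then obtain n1 par1 \<beta>1 where 1: "config n1 par1 \<beta>1" "n \<le> n1" "\<And>i. i < n \<Longrightarrow> \<beta>1 i = \<beta> i"
    "\<And>i. n \<le> i \<Longrightarrow> i < n1 \<Longrightarrow> \<exists>c\<in>I. \<beta>1 i \<subseteq> Xf c \<union> Pow (Yf c)"
    "\<And>c. c \<in> I \<Longrightarrow> covered (Yf c) n1 \<beta>1" by auto
  have free: "P \<inter> Yf d = {}" if "P \<in> \<beta> i" "i < n" "d \<in> insert c I" for P i d
    using insert.prems(5)[OF that(3)] that(1,2) by (auto simp: free_of_def)
  have Xp: "Xf d \<subseteq> \<beta> p" if "d \<in> insert c I" for d using insert.prems(4)[OF that] .
  have "\<exists>n' par' \<beta>'. config n' par' \<beta>' \<and> n1 \<le> n' \<and> (\<forall>i<n1. \<beta>' i = \<beta>1 i) \<and>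
        (\<forall>i. n1 \<le> i \<and> i < n' \<longrightarrow> \<beta>' i \<subseteq> Xf c \<union> Pow (Yf c)) \<and> covered (Yf c) n' \<beta>'"
  proof (rule insert.prems(1)[of c, unfolded solvable_def, rule_format, OF _ 1(1), of p])
    show "p < n1" using p 1(2) by simp
    show "Xf c \<subseteq> \<beta>1 p" using Xp[of c] 1(3)[OF p] by simp
    show "free_of n1 \<beta>1 (Yf c)" unfolding free_of_def
    proof (intro allI impI ballI)
      fix i P assume i: "i < n1" "P \<in> \<beta>1 i"
      show "P \<inter> Yf c = {}"
      proof (cases "i < n")
        case True
        then show ?thesis using free[of P i c] i 1(3) by simp
      next
        case False
        then obtain d where d: "d \<in> I" "\<beta>1 i \<subseteq> Xf d \<union> Pow (Yf d)" using 1(4)[of i] i by auto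
        have "c \<noteq> d" using d insert.hyps by auto
        then have "Yf c \<inter> Yf d = {}" using insert.prems(2)[of c d] d by auto
        moreover have "P \<in> \<beta> p \<or> P \<subseteq> Yf d" using d(2) i(2) Xp[of d] d(1) by auto
        ultimately show ?thesis using free[OF _ p, of P c] by auto
      qed
    qed
    assume s: "card (Xf c) = s"
    have "{i. i < n1 \<and> Xf c \<subseteq> \<beta>1 i} \<subseteq> {i. i < n \<and> Xf c \<subseteq> \<beta> i}"
    proof
      fix i assume i: "i \<in> {i. i < n1 \<and> Xf c \<subseteq> \<beta>1 i}"
      have "i < n"
      proof (rule ccontr)
        assume "\<not> i < n"
        then obtain d where d: "d \<in> I" "\<beta>1 i \<subseteq> Xf d \<union> Pow (Yf d)" using 1(4)[of i] i by auto
        have cd: "d \<noteq> c" using d insert.hyps by auto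
        \<comment> \<open>Members of \<open>Xf c\<close> are non-empty parts in bag
          \<open>p\<close>, hence disjoint from \<open>Yf d\<close>; a bag made for \<open>d\<close>
          can have them only from \<open>Xf d\<close>.\<close>
        have "Xf c \<subseteq> Xf d"
        proof
          fix P assume P: "P \<in> Xf c"
          then have Pp: "P \<in> \<beta> p" using Xp[of c] by auto
          then have "\<not> P \<subseteq> Yf d" using configD(7)[OF cfg p Pp] free[OF Pp p, of d] d(1) by auto
          then show "P \<in> Xf d" using P i d(2) by auto
        qed
        then show False using insert.prems(3)[of d c] cd d(1) s by auto
      qed
      then show "i \<in> {i. i < n \<and> Xf c \<subseteq> \<beta> i}" using i 1(3) by auto
    qed
    then have "card {i. i < n1 \<and> Xf c \<subseteq> \<beta>1 i} \<le> card {i. i < n \<and> Xf c \<subseteq> \<beta> i}"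
      by (intro card_mono) auto
    then show "card {i. i < n1 \<and> Xf c \<subseteq> \<beta>1 i} \<le> 1" using insert.prems(6)[of c] s by simp
  qed simp
  then obtain n2 par2 \<beta>2 where 2: "config n2 par2 \<beta>2" "n1 \<le> n2" "\<And>i. i < n1 \<Longrightarrow> \<beta>2 i = \<beta>1 i"
    "\<And>i. n1 \<le> i \<Longrightarrow> i < n2 \<Longrightarrow> \<beta>2 i \<subseteq> Xf c \<union> Pow (Yf c)" "covered (Yf c) n2 \<beta>2" by auto
  show ?case
  proof (intro exI[of _ n2] exI[of _ par2] exI[of _ \<beta>2] conjI allI impI ballI)
    show "config n2 par2 \<beta>2" by fact
    show "n \<le> n2" using 1 2 by simp
    show "\<beta>2 i = \<beta> i" if "i < n" for i using that 1(2,3) 2(3) by simp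
    show "covered (Yf d) n2 \<beta>2" if "d \<in> insert c I" for d
      using that 2(5) covered_extend[OF 1(5) 2(2,3)] by auto
    fix i assume i: "n \<le> i \<and> i < n2"
    show "\<exists>c\<in>insert c I. \<beta>2 i \<subseteq> Xf c \<union> Pow (Yf c)"
    proof (cases "i < n1")
      case True
      then show ?thesis using 1(4)[of i] 2(3)[of i] i by auto
    next
      case False
      then show ?thesis using 2(4)[of i] i by auto
    qed
  qed
qed

text \<open>\<open>S\<close> occurs in no older bag, so an \<open>s\<close>-set containing it is
  only in the new bag, while an \<open>s\<close>-set without it must be \<open>\<X>\<close> itself,
  for which \<open>one\<close> leaves room.\<close>

lemma config_attach:
  assumes cfg: "config n par \<beta>" and p: "p < n" and \<X>: "\<X> \<subseteq> \<beta> p" "card \<X> \<le> s"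
    and one: "card \<X> = s \<Longrightarrow> card {i. i < n \<and> \<X> \<subseteq> \<beta> i} \<le> 1"
    and S: "S \<noteq> {}" "S \<subseteq> V" "few_bags S" and free: "free_of n \<beta> S"
  shows "config (Suc n) (par(n := p)) (\<beta>(n := insert S \<X>))"
  unfolding config_def
proof (intro conjI allI impI ballI)
  let ?\<beta> = "\<beta>(n := insert S \<X>)"
  have fX: "finite \<X>" using \<X>(1) configD(3)[OF cfg p] by (rule finite_subset)
  have new: "S \<notin> \<beta> i" if "i < n" for i using free that S(1) by (auto simp: free_of_def)
  show "0 < Suc n" by simp
  show "(par(n := p)) i < i" if "0 < i \<and> i < Suc n" for i
    using that p configD(2)[OF cfg, of i] by auto
  show "finite (?\<beta> i)" if "i < Suc n" for i using that fX configD(3)[OF cfg, of i] by auto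
  show "card (?\<beta> i) \<le> Suc s" if "i < Suc n" for i
    using that fX \<X>(2) configD(4)[OF cfg, of i] by (auto simp: card_insert_if)
  show "P \<in> ?\<beta> ((par(n := p)) i) \<or> (\<forall>j<i. P \<notin> ?\<beta> j)" if "0 < i \<and> i < Suc n" "P \<in> ?\<beta> i" for i P
  proof (cases "i = n")
    case True
    then show ?thesis using that(2) p \<X>(1) new by auto
  next
    case False
    then have i: "0 < i" "i < n" using that by auto
    then show ?thesis
      using configD(2)[OF cfg i] configD(5)[OF cfg i, of P] that(2) by auto
  qed
  show "card {i. i < Suc n \<and> A \<subseteq> ?\<beta> i} \<le> 2" if A: "card A = s" for A
  proof (cases "A \<subseteq> insert S \<X>")
    case False
    then have "{i. i < Suc n \<and> A \<subseteq> ?\<beta> i} = {i. i < n \<and> A \<subseteq> \<beta> i}" by (auto simp: less_Suc_eq)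
    then show ?thesis using configD(6)[OF cfg A] by simp
  next
    case True
    then have eq: "{i. i < Suc n \<and> A \<subseteq> ?\<beta> i} = insert n {i. i < n \<and> A \<subseteq> \<beta> i}"
      by (auto simp: less_Suc_eq)
    have "card {i. i < n \<and> A \<subseteq> \<beta> i} \<le> 1"
    proof (cases "S \<in> A")
      case True
      then have "{i. i < n \<and> A \<subseteq> \<beta> i} = {}" using new by auto
      then show ?thesis by (simp only: card.empty)
    next
      case False
      then have "A \<subseteq> \<X>" using \<open>A \<subseteq> insert S \<X>\<close> by auto
      then have "A = \<X>" using card_seteq[OF fX] A \<X>(2) by auto
      then show ?thesis using one A by simp
    qed
    then show ?thesis unfolding eq by (simp add: card_insert_if)
  qed
  have parts: "P \<noteq> {} \<and> P \<subseteq> V \<and> few_bags P" if "i < Suc n" "P \<in> ?\<beta> i" for i P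
  proof (cases "i < n")
    case True
    then show ?thesis using configD(7-9)[OF cfg True, of P] that(2) by auto
  next
    case False
    then have "P = S \<or> P \<in> \<beta> p" using that \<X>(1) by auto
    then show ?thesis using S configD(7-9)[OF cfg p, of P] by auto
  qed
  then show "P \<noteq> {}" "P \<subseteq> V" "few_bags P" if "i < Suc n" "P \<in> ?\<beta> i" for i P
    using that by blast+
  show "P \<inter> Q = {}" if PQ: "i < Suc n" "j < Suc n" "P \<in> ?\<beta> i" "Q \<in> ?\<beta> j" "P \<noteq> Q" for i j P Q
  proof -
    have old: "P = S \<or> (\<exists>i<n. P \<in> \<beta> i)" if "i < Suc n" "P \<in> ?\<beta> i" for P i
      using that p \<X>(1) by (cases "i = n") auto
    have SP: "P \<inter> S = {}" if "i < n" "P \<in> \<beta> i" for P i using free that by (auto simp: free_of_def)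
    consider "P = S" "\<exists>j<n. Q \<in> \<beta> j" | "Q = S" "\<exists>i<n. P \<in> \<beta> i" | "\<exists>i<n. P \<in> \<beta> i" "\<exists>j<n. Q \<in> \<beta> j"
      using old[OF PQ(1,3)] old[OF PQ(2,4)] PQ(5) by blast
    then show ?thesis
    proof cases
      case 1
      then show ?thesis using SP[of _ Q] by auto
    next
      case 2
      then show ?thesis using SP[of _ P] by auto
    next
      case 3
      then show ?thesis using configD(10)[OF cfg _ _ _ _ PQ(5)] by blast
    qed
  qed
qed

section \<open>The induction\<close>

text \<open>The measure drops in both cases: without full sets a root is dropped and
  \<open>Y\<close> does not grow; otherwise \<open>Y\<close> loses the non-empty \<open>S\<close>
  and at most one root is added, which the factor 2 outweighs.\<close>

lemma solvable_if_rooted: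
  assumes "rooted \<X> B Y"
  shows "solvable \<X> Y"
  using assms
proof (induction "2 * card Y + card \<X>" arbitrary: \<X> B Y rule: less_induct)
  case less
  note r = less.prems
  have fY: "finite Y" by (rule rooted_finite[OF r])
  have fX: "finite \<X>" by (rule rootedD(1)[OF r])
  show ?case unfolding solvable_def
  proof (intro allI impI)
    fix n par \<beta> p
    assume cfg: "config n par \<beta>" and p: "p < n" and Xp: "\<X> \<subseteq> \<beta> p" and free: "free_of n \<beta> Y"
      and one: "card \<X> = s \<longrightarrow> card {i. i < n \<and> \<X> \<subseteq> \<beta> i} \<le> 1"
    have freeD: "P \<inter> Y = {}" if "i < n" "P \<in> \<beta> i" for i P using free that by (simp add: free_of_def)
    show "\<exists>n' par' \<beta>'. config n' par' \<beta>' \<and> n \<le> n' \<and> (\<forall>i<n. \<beta>' i = \<beta> i) \<and>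
        (\<forall>i. n \<le> i \<and> i < n' \<longrightarrow> \<beta>' i \<subseteq> \<X> \<union> Pow Y) \<and> covered Y n' \<beta>'"
    proof (cases "\<exists>Z\<subseteq>Y. full E \<X> Z")
      case False
      then have "\<forall>Z. Z \<subseteq> Y \<longrightarrow> \<not> full E \<X> Z" by simp
      from exists_labelling[OF sym_E this] obtain lab
        where lab: "\<And>v. v \<in> Y \<Longrightarrow> lab v \<in> \<X>"
          "\<And>u v. u \<in> Y \<Longrightarrow> v \<in> Y \<Longrightarrow> (u, v) \<in> E \<Longrightarrow> lab u = lab v"
          "\<And>v w. v \<in> Y \<Longrightarrow> (v, w) \<in> E \<Longrightarrow> w \<notin> lab v" by metis
      \<comment> \<open>\<open>DX X\<close> has no edges to \<open>X\<close>, so it is solved with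
        the roots \<open>\<X> - {X}\<close>; no new bag is attached before that.\<close>
      define DX where "DX X = {v \<in> Y. lab v = X}" for X
      have DXY: "DX X \<subseteq> Y" for X by (auto simp: DX_def)
      have small: "card (\<X> - {X}) < card \<X>" if "X \<in> \<X>" for X
        using card_Diff1_less[OF fX that] .
      have "\<exists>n' par' \<beta>'. config n' par' \<beta>' \<and> n \<le> n' \<and> (\<forall>i<n. \<beta>' i = \<beta> i) \<and>
          (\<forall>i. n \<le> i \<and> i < n' \<longrightarrow> (\<exists>X\<in>\<X>. \<beta>' i \<subseteq> (\<X> - {X}) \<union> Pow (DX X))) \<and>
          (\<forall>X\<in>\<X>. covered (DX X) n' \<beta>')"
      proof (rule solve_family[OF fX _ _ _ cfg p])
        fix X assume X: "X \<in> \<X>"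
        have "rooted (\<X> - {X}) B (DX X)"
        proof (rule rooted_drop[OF r X DXY])
          show "v \<in> DX X" if "u \<in> DX X" "(u, v) \<in> E" "v \<in> Y" for u v
            using that lab(2)[of u v] by (simp add: DX_def)
          show "\<not> adj E (DX X) X" using lab(3) by (auto simp: adj_def DX_def)
        qed
        moreover have "card (DX X) \<le> card Y" using fY DXY by (rule card_mono)
        ultimately show "solvable (\<X> - {X}) (DX X)"
          using less.hyps[of "DX X" "\<X> - {X}"] small[OF X] by simp
        show "\<X> - {X} \<subseteq> \<beta> p" using Xp by auto
        show "free_of n \<beta> (DX X)" using free DXY[of X] by (fastforce simp: free_of_def)
      next
        fix c d assume "c \<in> \<X>" "d \<in> \<X>" "c \<noteq> d" "card (\<X> - {d}) = s"
        then show "\<not> \<X> - {d} \<subseteq> \<X> - {c}" by auto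
      next
        \<comment> \<open>Fewer than \<open>s\<close> roots remain, so this bound holds
          vacuously.\<close>
        fix X assume X: "X \<in> \<X>" "card (\<X> - {X}) = s"
        then show "card {i. i < n \<and> \<X> - {X} \<subseteq> \<beta> i} \<le> 1" using small[OF X(1)] rootedD(2)[OF r] by simp
      qed (auto simp: DX_def)
      then obtain n' par' \<beta>' where *: "config n' par' \<beta>'" "n \<le> n'" "\<forall>i<n. \<beta>' i = \<beta> i"
        "\<And>i. n \<le> i \<Longrightarrow> i < n' \<Longrightarrow> \<exists>X\<in>\<X>. \<beta>' i \<subseteq> (\<X> - {X}) \<union> Pow (DX X)"
        "\<And>X. X \<in> \<X> \<Longrightarrow> covered (DX X) n' \<beta>'" by auto
      have "\<beta>' i \<subseteq> \<X> \<union> Pow Y" if "n \<le> i \<and> i < n'" for i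
        using *(4)[of i] that DXY by blast
      moreover have "covered Y n' \<beta>'" unfolding covered_def
      proof
        fix u assume u: "u \<in> Y"
        then have "u \<in> DX (lab u)" by (simp add: DX_def)
        with *(5)[OF lab(1)[OF u]]
        show "(\<exists>i<n'. \<exists>P\<in>\<beta>' i. u \<in> P) \<and>
            (\<forall>v. (u, v) \<in> E \<longrightarrow> (\<exists>i<n'. \<exists>P\<in>\<beta>' i. \<exists>Q\<in>\<beta>' i. u \<in> P \<and> v \<in> Q))"
          by (simp add: covered_def)
      qed
      ultimately show ?thesis using *(1-3) by blast
    next
      case True
      then obtain Z0 where Z0: "Z0 \<subseteq> Y" "full E \<X> Z0" by auto
      obtain D S Q where sep: "separates E \<X> Y D S"
        and min: "\<And>S'. S' \<subset> S \<Longrightarrow> \<not> separates E \<X> Y D S'"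
        and S: "S \<noteq> {}" "few_bags S" and D: "D \<subseteq> Y" "\<forall>d\<in>D. \<exists>Z\<subseteq>D. d \<in> Z \<and> full E \<X> Z"
        and Q: "full E \<X> Q" "Q \<subseteq> Y - D" "card \<X> < s \<longrightarrow> S \<subseteq> Q" "card \<X> = s \<longrightarrow> D = {}"
        using exists_minimal_separator[OF r Z0] by blast
      have SY: "S \<subseteq> Y" "D \<inter> S = {}"
        and sepE: "\<And>u v. u \<in> D \<Longrightarrow> v \<in> Y \<Longrightarrow> (u, v) \<in> E \<Longrightarrow> v \<in> D \<union> S"
        and nofull: "\<forall>Z. Z \<subseteq> Y - S - D \<longrightarrow> \<not> full E \<X> Z"
        using sep by (auto simp: separates_def)
      from exists_labelling[OF sym_E nofull] obtain lab
        where lab: "\<And>v. v \<in> Y - S - D \<Longrightarrow> lab v \<in> \<X>"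
          "\<And>u v. u \<in> Y - S - D \<Longrightarrow> v \<in> Y - S - D \<Longrightarrow> (u, v) \<in> E \<Longrightarrow> lab u = lab v"
          "\<And>v w. v \<in> Y - S - D \<Longrightarrow> (v, w) \<in> E \<Longrightarrow> w \<notin> lab v" by metis
      define DX where "DX X = {v \<in> Y - S - D. lab v = X}" for X
      have DXY: "DX X \<subseteq> Y - S - D" for X by (auto simp: DX_def)
      have SX: "S \<notin> \<X>" using Xp freeD[OF p] S(1) SY(1) by blast
      define \<beta>1 where "\<beta>1 = \<beta>(n := insert S \<X>)"
      have \<beta>1n: "\<beta>1 n = insert S \<X>" and \<beta>1o: "\<And>i. i < n \<Longrightarrow> \<beta>1 i = \<beta> i" by (auto simp: \<beta>1_def)
      have freeS: "free_of n \<beta> S" using freeD SY(1) by (fastforce simp: free_of_def)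
      have newS: "S \<notin> \<beta> i" if "i < n" for i using freeD[OF that] SY(1) S(1) by blast
      have cfg1: "config (Suc n) (par(n := p)) \<beta>1"
        unfolding \<beta>1_def
        by (rule config_attach[OF cfg p Xp rootedD(2)[OF r] _ S(1) _ S(2) freeS])
           (use one SY(1) rootedD(3)[OF r] in auto)
      \<comment> \<open>Index \<open>S\<close> stands for \<open>D\<close> with the roots
        \<open>insert S \<X>\<close>, an index in \<open>\<X>\<close> for its piece with
        \<open>S\<close> in its place. If \<open>\<X>\<close> has \<open>s\<close> members,
        \<open>D\<close> is empty and left out, as it would get too many roots.\<close>
      define I where "I = (if card \<X> < s then insert S \<X> else \<X>)"
      define Xf where "Xf c = (if c = S then insert S \<X> else insert S (\<X> - {c}))" for c
      define Yf where "Yf c = (if c = S then D else DX c)" for c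
      have I: "c = S \<and> card \<X> < s \<or> c \<in> \<X> \<and> c \<noteq> S" if "c \<in> I" for c
        using that SX by (auto simp: I_def split: if_splits)
      have XI: "X \<in> I" if "X \<in> \<X>" for X using that by (simp add: I_def)
      have Yf: "Yf c \<subseteq> Y - S" for c using D(1) SY(2) DXY[of c] by (auto simp: Yf_def)
      have SXf: "S \<in> Xf c" "Xf c \<subseteq> insert S \<X>" for c by (auto simp: Xf_def)
      have cS: "card (Yf c) < card Y" for c
        using Yf[of c] SY(1) S(1) fY by (intro psubset_card_mono) auto
      have cX: "card (Xf c) = card \<X>" if "c \<in> \<X>" for c
      proof -
        have "c \<noteq> S" using that SX by auto
        then have "card (Xf c) = Suc (card (\<X> - {c}))"
          using SX fX by (simp add: Xf_def)
        then show ?thesis using card_Suc_Diff1[OF fX that] by simp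
      qed
      have "\<exists>n' par' \<beta>'. config n' par' \<beta>' \<and> Suc n \<le> n' \<and> (\<forall>i<Suc n. \<beta>' i = \<beta>1 i) \<and>
          (\<forall>i. Suc n \<le> i \<and> i < n' \<longrightarrow> (\<exists>c\<in>I. \<beta>' i \<subseteq> Xf c \<union> Pow (Yf c))) \<and>
          (\<forall>c\<in>I. covered (Yf c) n' \<beta>')"
      proof (rule solve_family[OF _ _ _ _ cfg1, of _ _ _ n])
        show "finite I" using fX by (simp add: I_def)
        show "n < Suc n" by simp
      next
        fix c assume c: "c \<in> I"
        show "solvable (Xf c) (Yf c)"
        proof (cases "c = S")
          case True
          then have lt: "card \<X> < s" using I[OF c] by auto
          have "\<exists>B'. rooted (insert S \<X>) B' D"
            using rooted_extend[OF r lt sep S(1) D(1) Q(1,2)] Q(3) lt by simp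
          then obtain B' where "rooted (Xf c) B' (Yf c)" using True by (auto simp: Xf_def Yf_def)
          moreover have "card (Xf c) \<le> Suc (card \<X>)" using True fX by (simp add: Xf_def card_insert_if)
          ultimately show ?thesis using less.hyps[of "Yf c" "Xf c" B'] cS[of c] by simp
        next
          case False
          then have X: "c \<in> \<X>" using I[OF c] by auto
          have "\<exists>B'. rooted (insert S (\<X> - {c})) B' (DX c)"
          proof (rule rooted_exchange[OF r sep min S(1) D X DXY])
            show "v \<in> DX c" if "u \<in> DX c" "(u, v) \<in> E" "v \<in> Y - S - D" for u v
              using that lab(2)[of u v] by (simp add: DX_def)
            show "\<not> adj E (DX c) c" using lab(3) by (auto simp: adj_def DX_def)
          qed
          then obtain B' where "rooted (Xf c) B' (Yf c)" using False by (auto simp: Xf_def Yf_def)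
          then show ?thesis using less.hyps[of "Yf c" "Xf c" B'] cS[of c] cX[OF X] by simp
        qed
        show "Xf c \<subseteq> \<beta>1 n" using SXf \<beta>1n by simp
        show "free_of (Suc n) \<beta>1 (Yf c)" unfolding free_of_def
        proof (intro allI impI ballI)
          fix i P assume i: "i < Suc n" "P \<in> \<beta>1 i"
          have "P = S \<or> (\<exists>j<n. P \<in> \<beta> j)"
            using i \<beta>1n \<beta>1o[of i] Xp p by (cases "i = n") auto
          then have "P = S \<or> P \<inter> Y = {}" using freeD by auto
          then show "P \<inter> Yf c = {}" using Yf[of c] by auto
        qed
        \<comment> \<open>\<open>S\<close> is new and belongs to every \<open>Xf c\<close>, so only
          the bag just attached can contain \<open>Xf c\<close>.\<close>
        have "{i. i < Suc n \<and> Xf c \<subseteq> \<beta>1 i} \<subseteq> {n}"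
          using newS \<beta>1o SXf(1)[of c] by (auto simp: less_Suc_eq)
        then have "card {i. i < Suc n \<and> Xf c \<subseteq> \<beta>1 i} \<le> card {n}" by (intro card_mono) auto
        then show "card {i. i < Suc n \<and> Xf c \<subseteq> \<beta>1 i} \<le> 1" by simp
      next
        fix c d assume cd: "c \<in> I" "d \<in> I" "c \<noteq> d"
        show "Yf c \<inter> Yf d = {}" using cd(3) by (auto simp: Yf_def DX_def)
        assume s: "card (Xf d) = s"
        \<comment> \<open>For \<open>c = S\<close> there are fewer than \<open>s\<close> roots, and
          \<open>Xf d\<close> is no larger than \<open>\<X>\<close>. Otherwise \<open>c\<close>
          itself lies in \<open>Xf d\<close> but not in \<open>Xf c\<close>.\<close>
        have "c \<noteq> S"
        proof
          assume "c = S"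
          then have "d \<in> \<X>" "card \<X> < s" using I[OF cd(1)] I[OF cd(2)] cd(3) by auto
          then show False using s cX by simp
        qed
        then have "c \<in> \<X>" using I[OF cd(1)] by auto
        then have "c \<in> Xf d" "c \<notin> Xf c" using cd(3) \<open>c \<noteq> S\<close> by (auto simp: Xf_def)
        then show "\<not> Xf d \<subseteq> Xf c" by auto
      qed
      then obtain n' par' \<beta>' where *: "config n' par' \<beta>'" "Suc n \<le> n'" "\<And>i. i < Suc n \<Longrightarrow> \<beta>' i = \<beta>1 i"
        "\<And>i. Suc n \<le> i \<Longrightarrow> i < n' \<Longrightarrow> \<exists>c\<in>I. \<beta>' i \<subseteq> Xf c \<union> Pow (Yf c)"
        "\<And>c. c \<in> I \<Longrightarrow> covered (Yf c) n' \<beta>'" by auto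
      have \<beta>'n: "\<beta>' n = insert S \<X>" "n < n'" using *(2,3) \<beta>1n by auto
      have sub: "\<beta>' i \<subseteq> \<X> \<union> Pow Y" if "n \<le> i \<and> i < n'" for i
      proof (cases "i = n")
        case True
        then show ?thesis using \<beta>'n SY(1) by auto
      next
        case False
        then have "Suc n \<le> i" "i < n'" using that by auto
        then obtain c where "\<beta>' i \<subseteq> Xf c \<union> Pow (Yf c)" using *(4) by blast
        then show ?thesis using SXf(2)[of c] Yf[of c] SY(1) by blast
      qed
      have part: "\<exists>c\<in>I. u \<in> Yf c" if "u \<in> Y - S" for u
      proof (cases "u \<in> D")
        case True
        \<comment> \<open>A non-empty \<open>D\<close> forces fewer than \<open>s\<close>
          roots.\<close>
        then have "S \<in> I" using Q(4) rootedD(2)[OF r] by (auto simp: I_def)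
        then show ?thesis using True by (auto simp: Yf_def)
      next
        case False
        then have u: "u \<in> Y - S - D" using that by auto
        have "lab u \<in> I" "lab u \<noteq> S" using XI[OF lab(1)[OF u]] lab(1)[OF u] SX by auto
        then show ?thesis using u by (auto simp: Yf_def DX_def)
      qed
      have "covered Y n' \<beta>'" unfolding covered_def
      proof (intro ballI)
        fix u assume u: "u \<in> Y"
        have edge: "\<exists>i<n'. \<exists>P\<in>\<beta>' i. \<exists>Q\<in>\<beta>' i. w \<in> P \<and> v \<in> Q" if "w \<in> Y - S" "(w, v) \<in> E" for w v
          using part[OF that(1)] *(5) that(2) unfolding covered_def by blast
        show "(\<exists>i<n'. \<exists>P\<in>\<beta>' i. u \<in> P) \<and>
            (\<forall>v. (u, v) \<in> E \<longrightarrow> (\<exists>i<n'. \<exists>P\<in>\<beta>' i. \<exists>Q\<in>\<beta>' i. u \<in> P \<and> v \<in> Q))"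
        proof (cases "u \<in> S")
          case False
          then have "\<exists>i<n'. \<exists>P\<in>\<beta>' i. u \<in> P"
            using part[of u] u *(5) unfolding covered_def by blast
          then show ?thesis using edge[of u] u False by blast
        next
          case True
          \<comment> \<open>An edge from \<open>S\<close> to \<open>Y - S\<close> is covered by the
            piece of its other end; the remaining ones end in \<open>S\<close> or in a root and lie
            in bag \<open>n\<close>.\<close>
          have "\<exists>i<n'. \<exists>P\<in>\<beta>' i. \<exists>Q\<in>\<beta>' i. u \<in> P \<and> v \<in> Q" if "(u, v) \<in> E" for v
          proof (cases "v \<in> Y - S")
            case True
            then show ?thesis using edge[OF True E_sym[OF that]] by blast
          next
            case False
            then have "v \<in> S \<union> \<Union>\<X>" using rootedD(11)[OF r u that] by auto
            then show ?thesis using \<beta>'n \<open>u \<in> S\<close> by (intro exI[of _ n]) auto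
          qed
          moreover have "\<exists>i<n'. \<exists>P\<in>\<beta>' i. u \<in> P" using \<beta>'n True by (intro exI[of _ n]) auto
          ultimately show ?thesis by blast
        qed
      qed
      moreover have "\<forall>i<n. \<beta>' i = \<beta> i" using *(3) \<beta>1o by simp
      moreover have "n \<le> n'" using *(2) by simp
      ultimately show ?thesis using *(1) sub by blast
    qed
  qed
qed

section \<open>The quotient graph\<close>

lemma exists_config:
  "\<exists>n par \<beta>. config n par \<beta> \<and> covered V n \<beta>"
proof -
  \<comment> \<open>Growth starts from one empty bag, no roots, and all of \<open>V\<close> still to
    be partitioned.\<close>
  have "config 1 (\<lambda>_. 0) (\<lambda>_. {})"
  proof -
    have "card {i :: nat. i = 0 \<and> A = {}} \<le> 2" for A :: "'a set set"
      by (rule order_trans[OF card_mono[of "{0}"]]) auto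
    then show ?thesis by (auto simp: config_def)
  qed
  moreover have "rooted {} (\<lambda>_. {}) V"
  proof -
    interpret pair_graph G by (rule graph)
    show ?thesis by (auto simp: rooted_def in_arcsD2)
  qed
  then have "solvable {} V" by (rule solvable_if_rooted)
  ultimately show ?thesis
    using s unfolding solvable_def free_of_def
    by (elim allE[of _ 1] allE[of _ "\<lambda>_. 0"] allE[of _ "\<lambda>_. {}"] allE[of _ 0]) auto
qed

lemma simple_quotient:
  "\<exists>H. graph_partition G H \<and> partition_bag_width T W H \<le> t - 1 \<and> simple_treewidth H \<le> s"
proof -
  obtain n par \<beta> where cfg: "config n par \<beta>" and cov: "covered V n \<beta>"
    using exists_config by auto
  define \<P> where "\<P> = (\<Union>i<n. \<beta> i)"
  \<comment> \<open>Parts are adjacent as soon as they share a bag. This may exceed the plain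
    quotient, which \<open>graph_partition\<close> permits, and makes the edge condition of the tree
    decomposition immediate.\<close>
  define H where "H = \<lparr>pverts = \<P>, parcs = {(P, Q). P \<noteq> Q \<and> (\<exists>i<n. P \<in> \<beta> i \<and> Q \<in> \<beta> i)}\<rparr>"
  have vH: "pverts H = \<P>" and aH: "parcs H = {(P, Q). P \<noteq> Q \<and> (\<exists>i<n. P \<in> \<beta> i \<and> Q \<in> \<beta> i)}"
    by (simp_all add: H_def)
  have P: "P \<noteq> {}" "P \<subseteq> V" "few_bags P" if PP: "P \<in> \<P>" for P
  proof -
    obtain i where "i < n" "P \<in> \<beta> i" using PP by (auto simp: \<P>_def)
    then show "P \<noteq> {}" "P \<subseteq> V" "few_bags P" by (fact configD(7-9)[OF cfg])+
  qed
  have fP: "finite \<P>" using configD(3)[OF cfg] by (auto simp: \<P>_def)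
  have disj: "P = Q" if "P \<in> \<P>" "Q \<in> \<P>" "v \<in> P" "v \<in> Q" for P Q v
    using configD(10)[OF cfg, of _ _ P Q] that by (auto simp: \<P>_def)
  have "pair_graph H"
  proof
    show "finite (pverts H)" using fP by (simp add: vH)
    show "finite (parcs H)"
      by (rule finite_subset[of _ "\<P> \<times> \<P>"]) (use fP in \<open>auto simp: aH \<P>_def\<close>)
    show "symmetric (with_proj H)" by (auto simp: symmetric_def sym_def aH)
  qed (auto simp: aH vH \<P>_def)
  moreover have "\<exists>!X. X \<in> pverts H \<and> v \<in> X" if v: "v \<in> V" for v
  proof -
    obtain i X where "i < n" "X \<in> \<beta> i" and X: "v \<in> X" using cov v unfolding covered_def by blast
    then have "X \<in> \<P>" by (auto simp: \<P>_def)
    then show ?thesis unfolding vH using X disj by (intro ex1I[of _ X]) blast+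
  qed
  moreover have "X = X' \<or> (X, X') \<in> parcs H"
    if vw: "(v, w) \<in> E" "X \<in> pverts H" "X' \<in> pverts H" "v \<in> X" "w \<in> X'" for v w X X'
  proof -
    have "v \<in> V" using P(2)[of X] vw by (auto simp: vH)
    then obtain i A B where i: "i < n" "A \<in> \<beta> i" "B \<in> \<beta> i" "v \<in> A" "w \<in> B"
      using cov vw(1) unfolding covered_def by blast
    then have "A \<in> \<P>" "B \<in> \<P>" by (auto simp: \<P>_def)
    then have "A = X" "B = X'" using disj[of A X v] disj[of B X' w] i vw by (simp_all add: vH)
    then show ?thesis using i by (auto simp: aH)
  qed
  ultimately have part: "graph_partition G H"
    unfolding graph_partition_def using P(2) unfolding vH by blast
  have "set_bag_width T W S \<le> t - 1" if S: "S \<in> \<P>" for S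
  proof -
    obtain X where X: "X \<subseteq> pverts T" "card X \<le> t - 1" "S \<subseteq> (\<Union>x\<in>X. W x)"
      using P(3)[OF S] unfolding few_bags_def by blast
    then have "set_bag_width T W S \<le> card X"
      unfolding set_bag_width_def by (intro Least_le) auto
    then show ?thesis using X(2) by simp
  qed
  \<comment> \<open>\<open>cSUP_least\<close> wants a non-empty family; with no parts the supremum
    is 0.\<close>
  then have width: "partition_bag_width T W H \<le> t - 1"
    unfolding partition_bag_width_def vH
    by (cases "\<P> = {}") (auto intro: cSUP_least)
  let ?T = "parent_tree n par"
  have vT: "pverts ?T = {..<n}" by (simp add: parent_tree_def)
  have td: "tree_decomposition H ?T \<beta>"
    unfolding tree_decomposition_def
  proof (intro conjI ballI)
    show "undirected_tree ?T"
      using configD(1,2)[OF cfg] by (rule undirected_tree_parent_tree)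
    show "\<beta> x \<subseteq> pverts H" if "x \<in> pverts ?T" for x using that by (auto simp: vT vH \<P>_def)
    show "connected (with_proj ?T \<restriction> {x \<in> pverts ?T. X \<in> \<beta> x})" if X: "X \<in> pverts H" for X
    proof -
      let ?N = "{x \<in> pverts ?T. X \<in> \<beta> x}"
      have fin: "finite ?N" by (simp add: vT)
      have ne: "?N \<noteq> {}" using X by (auto simp: vT vH \<P>_def)
      have "conn (parcs ?T) ?N"
      \<comment> \<open>The first node containing a part tops its subtree; any later one does not
        introduce the part, so its parent contains it too.\<close>
      proof (rule conn_parent_tree[where m = "Min ?N"])
        show "par i < i" if "0 < i" "i < n" for i using configD(2)[OF cfg that] .
        show "?N \<subseteq> {..<n}" by (auto simp: vT)
        show "Min ?N \<in> ?N" using fin ne by (rule Min_in)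
        then have mN: "Min ?N < n" "X \<in> \<beta> (Min ?N)" by (auto simp: vT)
        fix i assume i: "i \<in> ?N" "i \<noteq> Min ?N"
        then have lt: "Min ?N < i" using Min_le[OF fin i(1)] by simp
        have i': "0 < i" "i < n" "X \<in> \<beta> i" using lt i(1) by (auto simp: vT)
        have "X \<in> \<beta> (par i)" using configD(5)[OF cfg i'] lt mN(2) by blast
        then show "0 < i \<and> par i \<in> ?N" using i' configD(2)[OF cfg i'(1,2)] by (auto simp: vT)
      qed
      then show ?thesis by (simp add: connected_induce_iff_conn[OF sym_parent_tree])
    qed
    show "case e of (X, X') \<Rightarrow> \<exists>x\<in>pverts ?T. X \<in> \<beta> x \<and> X' \<in> \<beta> x" if "e \<in> parcs H" for e
      using that by (auto simp: aH vT)
  qed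
  have "Max ((\<lambda>x. card (\<beta> x)) ` pverts ?T) \<le> Suc s"
    using configD(1,4)[OF cfg] by (intro Max.boundedI) (auto simp: vT)
  then have "td_width ?T \<beta> \<le> int s" by (simp add: td_width_def)
  moreover have "card {x \<in> pverts ?T. A \<subseteq> \<beta> x} \<le> 2" if "card A = s" for A
    using configD(6)[OF cfg that] by (simp add: vT)
  ultimately have "simple_tree_decomposition s H ?T \<beta>"
    using td by (simp add: simple_tree_decomposition_def)
  then have "simple_treewidth H \<le> s"
    unfolding simple_treewidth_def by (intro Least_le) blast
  then show ?thesis using part width by blast
qed

end

theorem theorem27:
  fixes s t :: nat
    and G :: "'a pair_pre_digraph"
    and T :: "'x pair_pre_digraph"
    and W :: "'x \<Rightarrow> 'a set"
  assumes "2 \<le> s" and "2 \<le> t"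
    and "pair_graph G"
    and "minor_free (K_star s t) G"
    and "tree_decomposition G T W"
  shows "\<exists>H. graph_partition G H \<and> partition_bag_width T W H \<le> t - 1 \<and>
             simple_treewidth H \<le> s"
proof -
  have "excluded_K_star G T W s t"
    using assms by (simp add: excluded_K_star_def)
  then show ?thesis by (rule excluded_K_star.simple_quotient)
qed

end
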